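(* For any integer $p \ge 0$ and any real $\nu \in [0,1]$, the derivative $D^p f_{p+\nu}$, where $f_{p+\nu}(x) := \|x\|^{p+\nu}$ for $x \in \mathbb{E}$, is $\nu$-Hölder continuous on $\mathbb{E}$ with constant $$A_{p,\nu} := \begin{cases} (p-1)!!\,\prod_{i=1}^{p/2} (\nu+2i) + H_{p,\nu}, & \text{if } p \text{ is even},\\ 2^{1-\nu}\prod_{i=1}^p (\nu+i), & \text{if } p \text{ is odd},\end{cases}$$ where $H_{p,\nu}$ is the constant of $\nu$-Hölder continuity of the polynomial $g_{p,p+\nu}$ on $[0,1]$; that is, $\|D^p f_{p+\nu}(x_2) - D^p f_{p+\nu}(x_1)\| \le A_{p,\nu}\|x_2-x_1\|^\nu$ for all $x_1,x_2\in\mathbb{E}$. In particular, $D^p f_{p+\nu}$ is $\nu$-Hölder continuous on $\mathbb{E}$ with constant $$\tilde A_{p,\nu} := \begin{cases} (p-1)!!\,\prod_{i=1}^{p/2} (\nu+2i) + \prod_{i=1}^p(\nu+i), & \text{if } p \text{ is even},\\ 2^{1-\nu}\prod_{i=1}^p (\nu+i), & \text{if } p \text{ is odd}.\end{cases}$$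
   Context: $\mathbb{E}$ is a finite-dimensional real vector space with dual space $\mathbb{E}^*$; $\langle s, x\rangle$ denotes the value of $s \in \mathbb{E}^*$ at $x \in \mathbb{E}$. A self-adjoint positive definite operator $B : \mathbb{E} \to \mathbb{E}^*$ is fixed, and $\|x\| := \langle Bx, x\rangle^{1/2}$. $D^p f$ denotes the $p$-th derivative of $f$ (with $D^0 f = f$); $D^p f(x)$ is a symmetric $p$-multilinear form on $\mathbb{E}$. The norm of a $p$-multilinear form $L$ is $\|L\| := \max_{\|h_1\|=\dots=\|h_p\|=1} |L[h_1,\dots,h_p]|$ (the absolute value when $p=0$). The polynomials $g_{p,q} : \mathbb{R} \to \mathbb{R}$ (integer $p \ge 0$, real $q$) are defined recursively by $g_{0,q}(\tau) := 1$ and, for $p \ge 1$, $g_{p,q}(\tau) := (1-\tau^2)\, g_{p-1,q}'(\tau) + (q-p+1)\,\tau\, g_{p-1,q}(\tau)$, where the prime denotes differentiation in $\tau$. The Hölder constant of $g_{p,p+\nu}$ on $[0,1]$ is $H_{p,\nu} := \max_{0 \le \tau_1 < \tau_2 \le 1} \frac{g_{p,p+\nu}(\tau_2) - g_{p,p+\nu}(\tau_1)}{(\tau_2-\tau_1)^\nu}$ (no absolute value is needed because $g_{p,p+\nu}$ is monotonically increasing on $[0,1]$). For a positive integer $n$, $n!!$ is the product of all integers between $1$ and $n$ with the same parity as $n$; $(-1)!! = 0!! = 1$. Empty products equal $1$.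
   Formalization: For p odd and ν = 0 the derivative D^p f_p does not exist at x = 0 (e.g. the norm, p = 1); there it is taken to be the zero form. The maximum defining H_{p,ν}, not always attained, is read as a supremum, and E is assumed nonzero. *)

theory Defs
  imports "HOL-Analysis.Analysis" "HOL-Computational_Algebra.Polynomial"
begin

(* Real power x^a of a number x >= 0 with 0^0 = 1; powr has 0 powr 0 = 0. *)
definition rpow :: "real \<Rightarrow> real \<Rightarrow> real" where
  "rpow x a = (if a = 0 then 1 else x powr a)"

(* The space E is the vector space underlying 'a and its dual is 'a \<Rightarrow>\<^sub>L real. The inner
   product and norm of the type 'a serve only as a source of the (unique) vector space
   topology of E; the Euclidean structure of E is the one given by B. *)
definition selfadjoint_posdef :: "('a::euclidean_space \<Rightarrow> ('a \<Rightarrow>\<^sub>L real)) \<Rightarrow> bool" where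
  "selfadjoint_posdef B \<longleftrightarrow>
     linear B \<and>
     (\<forall>x y. blinfun_apply (B x) y = blinfun_apply (B y) x) \<and>
     (\<forall>x. x \<noteq> 0 \<longrightarrow> blinfun_apply (B x) x > 0)"

definition enorm :: "('a::euclidean_space \<Rightarrow> ('a \<Rightarrow>\<^sub>L real)) \<Rightarrow> 'a \<Rightarrow> real" where
  "enorm B x = sqrt (blinfun_apply (B x) x)"

(* A p-multilinear form L is represented by a function on lists, with L[h_1,...,h_p] the
   value at a list of length p; values at other lists are irrelevant. For p = 0 the norm is
   \<bar>L []\<bar>. *)
definition form_norm ::
    "('a::euclidean_space \<Rightarrow> ('a \<Rightarrow>\<^sub>L real)) \<Rightarrow> nat \<Rightarrow> ('a list \<Rightarrow> real) \<Rightarrow> real" where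
  "form_norm B p L = Sup {\<bar>L hs\<bar> |hs. length hs = p \<and> (\<forall>h\<in>set hs. enorm B h = 1)}"

(* D^{p+1} f(x)[h, h_1, ..., h_p] is the derivative at x in direction h of
   y \<mapsto> D^p f(y)[h_1, ..., h_p]. *)
primrec nth_frechet ::
    "nat \<Rightarrow> ('a::euclidean_space \<Rightarrow> real) \<Rightarrow> 'a \<Rightarrow> 'a list \<Rightarrow> real" where
  "nth_frechet 0 f x hs = f x"
| "nth_frechet (Suc p) f x hs =
     frechet_derivative (\<lambda>y. nth_frechet p f y (tl hs)) (at x) (hd hs)"

(* f is p+1 times differentiable at x if it is p times differentiable near x and the
   form-valued map D^p f is Frechet differentiable at x. As the space of p-multilinear forms
   is finite-dimensional, the latter is differentiability of D^p f(.)[h_1, ..., h_p] for all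
   h_1, ..., h_p. *)
primrec nth_differentiable_at ::
    "nat \<Rightarrow> ('a::euclidean_space \<Rightarrow> real) \<Rightarrow> 'a \<Rightarrow> bool" where
  "nth_differentiable_at 0 f x \<longleftrightarrow> True"
| "nth_differentiable_at (Suc p) f x \<longleftrightarrow>
     (\<forall>\<^sub>F y in nhds x. nth_differentiable_at p f y) \<and>
     (\<forall>hs. length hs = p \<longrightarrow> (\<lambda>y. nth_frechet p f y hs) differentiable (at x))"

(* The p-th derivative, with the zero form as its value at points where f is not p times
   differentiable. For the functions \<parallel>x\<parallel>^(p+\<nu>) with 0 \<le> \<nu> \<le> 1 this concerns only x = 0 with
   p odd and \<nu> = 0 (e.g. the gradient of the norm at 0). *)
definition nth_derivative ::
    "nat \<Rightarrow> ('a::euclidean_space \<Rightarrow> real) \<Rightarrow> 'a \<Rightarrow> 'a list \<Rightarrow> real" where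
  "nth_derivative p f x =
     (if nth_differentiable_at p f x then nth_frechet p f x else (\<lambda>hs. 0))"

definition form_holder ::
    "('a::euclidean_space \<Rightarrow> ('a \<Rightarrow>\<^sub>L real)) \<Rightarrow> nat \<Rightarrow> real \<Rightarrow> real \<Rightarrow>
     ('a \<Rightarrow> 'a list \<Rightarrow> real) \<Rightarrow> bool" where
  "form_holder B p \<nu> C F \<longleftrightarrow>
     (\<forall>x1 x2. form_norm B p (\<lambda>hs. F x2 hs - F x1 hs) \<le> C * rpow (enorm B (x2 - x1)) \<nu>)"

definition norm_power ::
    "('a::euclidean_space \<Rightarrow> ('a \<Rightarrow>\<^sub>L real)) \<Rightarrow> real \<Rightarrow> 'a \<Rightarrow> real" where
  "norm_power B q x = rpow (enorm B x) q"

primrec gpoly :: "nat \<Rightarrow> real \<Rightarrow> real poly" where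
  "gpoly 0 q = 1"
| "gpoly (Suc p) q =
     [:1, 0, -1:] * pderiv (gpoly p q) + [:0, q - real (Suc p) + 1:] * gpoly p q"

(* A supremum: for \<nu> = 1 it is in general only approached as \<tau>2 - \<tau>1 tends to 0. *)
definition H_const :: "nat \<Rightarrow> real \<Rightarrow> real" where
  "H_const p \<nu> =
     Sup {(poly (gpoly p (real p + \<nu>)) \<tau>2 - poly (gpoly p (real p + \<nu>)) \<tau>1) / rpow (\<tau>2 - \<tau>1) \<nu>
          |\<tau>1 \<tau>2. 0 \<le> \<tau>1 \<and> \<tau>1 < \<tau>2 \<and> \<tau>2 \<le> 1}"

definition double_fact :: "int \<Rightarrow> int" where
  "double_fact n = \<Prod>{i \<in> {1..n}. even i \<longleftrightarrow> even n}"

definition A_const :: "nat \<Rightarrow> real \<Rightarrow> real" where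
  "A_const p \<nu> =
     (if even p
      then of_int (double_fact (int p - 1)) * (\<Prod>i=1..p div 2. \<nu> + 2 * real i) + H_const p \<nu>
      else 2 powr (1 - \<nu>) * (\<Prod>i=1..p. \<nu> + real i))"

definition A_tilde_const :: "nat \<Rightarrow> real \<Rightarrow> real" where
  "A_tilde_const p \<nu> =
     (if even p
      then of_int (double_fact (int p - 1)) * (\<Prod>i=1..p div 2. \<nu> + 2 * real i)
           + (\<Prod>i=1..p. \<nu> + real i)
      else 2 powr (1 - \<nu>) * (\<Prod>i=1..p. \<nu> + real i))"

end

theory Submission
  imports Defs "HOL-Probability.Probability"
begin

text \<open>
  The idea is to replace the radial function \<open>\<parallel>x\<parallel>\<^sup>q\<close>, \<open>q = p + \<nu>\<close>, by an average of
  one-dimensional powers. If \<open>\<xi>\<close> is the Gaussian field on the space whose covariance is the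
  inner product given by \<open>B\<close>, then \<open>\<xi> x\<close> is a centred normal variable with standard deviation
  \<open>\<parallel>x\<parallel>\<close> and depends linearly on \<open>x\<close>, so that \<open>E \<bar>\<xi> x\<bar>\<^sup>q = m\<^sub>q \<parallel>x\<parallel>\<^sup>q\<close> with \<open>m\<^sub>q\<close> the absolute
  moment of the standard normal law. Differentiating \<open>k\<close> times under the expectation gives

    \<open>D\<^sup>k \<parallel>x\<parallel>\<^sup>q [h\<^sub>1, \<dots>, h\<^sub>k] = q (q - 1) \<cdots> (q - k + 1) / m\<^sub>q * E (s\<^sub>k (\<xi> x) \<xi> h\<^sub>1 \<cdots> \<xi> h\<^sub>k)\<close>,

  where \<open>s\<^sub>k\<close> is the power \<open>q - k\<close> of the absolute value, multiplied by the sign for odd \<open>k\<close>.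
  For \<open>k = p\<close> the exponent is \<open>\<nu>\<close>, and the factor in front is \<open>(\<nu> + 1) \<cdots> (\<nu> + p) / m\<^sub>q\<close>.

  The Hoelder estimate is then one-dimensional: \<open>\<bar>a\<bar>\<^sup>\<nu>\<close> is \<open>\<nu>\<close>-Hoelder continuous with constant \<open>1\<close>
  and \<open>sgn a \<bar>a\<bar>\<^sup>\<nu>\<close> with constant \<open>2 powr (1 - \<nu>)\<close> (\<open>spow_holder\<close>). It remains to bound
  \<open>E (\<bar>\<xi> d\<bar>\<^sup>\<nu> \<bar>\<xi> h\<^sub>1\<bar> \<cdots> \<bar>\<xi> h\<^sub>p\<bar>)\<close>, \<open>d = x\<^sub>2 - x\<^sub>1\<close>, by \<open>m\<^sub>q \<parallel>d\<parallel>\<^sup>\<nu>\<close> for unit vectors \<open>h\<^sub>i\<close>,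
  which is the weighted inequality of the arithmetic and geometric means applied pointwise
  (\<open>expectation_mixed_moment_le\<close>). Thus \<open>D\<^sup>p\<close> is \<open>\<nu>\<close>-Hoelder continuous with constant
  \<open>(\<nu> + 1) \<cdots> (\<nu> + p)\<close> for even \<open>p\<close>, and \<open>2 powr (1 - \<nu>)\<close> times this product for odd \<open>p\<close>
  (\<open>form_holder_norm_power\<close>).

  For odd \<open>p\<close> this is the claimed constant. For even \<open>p\<close>, the product is the value \<open>g(1)\<close> of the
  polynomial \<open>g = g\<^bsub>p,p+\<nu>\<^esub>\<close>, while \<open>(p - 1)!! (\<nu> + 2) (\<nu> + 4) \<cdots> (\<nu> + p) = g(0)\<close>. The
  difference quotient of \<open>g\<close> between \<open>0\<close> and \<open>1\<close> shows \<open>H\<^bsub>p,\<nu>\<^esub> \<ge> g(1) - g(0)\<close>, hence both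
  constants are at least \<open>g(1)\<close>.
\<close>

section \<open>Signed real powers\<close>

lemma rpow_nonneg: "0 \<le> rpow a r"
  by (simp add: rpow_def)

lemma rpow_mult: "0 \<le> a \<Longrightarrow> 0 \<le> b \<Longrightarrow> rpow (a * b) r = rpow a r * rpow b r"
  by (simp add: rpow_def powr_mult)

lemma rpow_mono: "0 \<le> r \<Longrightarrow> 0 \<le> a \<Longrightarrow> a \<le> b \<Longrightarrow> rpow a r \<le> rpow b r"
  by (simp add: rpow_def powr_mono2)

lemma rpow_one [simp]: "rpow 1 r = 1"
  by (simp add: rpow_def)

lemma rpow_le_power:
  assumes "0 \<le> a" "a \<le> T" "1 \<le> T" "0 \<le> r" "r \<le> real m"
  shows "rpow a r \<le> T ^ m"
proof -
  have "rpow a r \<le> rpow T r"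
    using assms by (intro rpow_mono) auto
  also have "\<dots> \<le> T powr real m"
    using assms by (auto simp: rpow_def intro: powr_mono ge_one_powr_ge_zero)
  also have "\<dots> = T ^ m"
    using assms by (simp add: powr_realpow)
  finally show ?thesis .
qed

lemma borel_measurable_rpow [measurable]: "(\<lambda>a. rpow a r) \<in> borel_measurable borel"
  unfolding rpow_def by measurable

text \<open>For even \<open>k\<close> the power of the absolute value, for odd \<open>k\<close> its odd extension: up to a constant
factor and away from \<open>0\<close>, the \<open>k\<close>-th derivative of \<open>\<bar>a\<bar> powr (r + k)\<close>. Because \<open>rpow\<close> has the value \<open>1\<close> at exponent
\<open>0\<close>, the even power with \<open>r = 0\<close> is the constant \<open>1\<close>, also at \<open>a = 0\<close>.\<close>
definition spow :: "nat \<Rightarrow> real \<Rightarrow> real \<Rightarrow> real" where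
  "spow k r a = (if odd k then sgn a else 1) * rpow \<bar>a\<bar> r"

lemma borel_measurable_spow [measurable]: "spow k r \<in> borel_measurable borel"
  unfolding spow_def[abs_def] by measurable

lemma abs_spow_le: "\<bar>spow k r a\<bar> \<le> rpow \<bar>a\<bar> r"
  by (simp add: spow_def abs_mult rpow_nonneg sgn_if)

lemma spow_even: "even k \<Longrightarrow> spow k r a = rpow \<bar>a\<bar> r"
  by (simp add: spow_def)

lemma spow_minus: "spow k r (- a) = (if odd k then - spow k r a else spow k r a)"
  by (simp add: spow_def sgn_minus)

lemma spow_odd_one: "odd k \<Longrightarrow> spow k 1 a = a"
  by (simp add: spow_def rpow_def sgn_mult_abs)

text \<open>The only singular case is \<open>\<bar>a\<bar>\<close> at the origin; for \<open>r > 1\<close> the derivative vanishes there, and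
\<open>sgn a * \<bar>a\<bar>\<close> is the identity.\<close>
lemma has_real_derivative_spow:
  assumes "1 \<le> r" and sing: "r = 1 \<Longrightarrow> odd k \<or> a \<noteq> 0"
  shows "(spow k r has_real_derivative r * spow (Suc k) (r - 1) a) (at a)"
proof (cases "a = 0")
  case False
  define c where "c = (if odd k then sgn a else 1)"
  have "((\<lambda>y. c * (sgn a * y) powr r) has_real_derivative
          c * (r * (sgn a * a) powr (r - 1) * sgn a)) (at a)"
    using False by (auto intro!: derivative_eq_intros simp: powr_diff sgn_if)
  moreover have "c * (r * (sgn a * a) powr (r - 1) * sgn a) = r * spow (Suc k) (r - 1) a"
    using False by (auto simp: c_def spow_def rpow_def sgn_if)
  moreover have "\<forall>\<^sub>F y in nhds a. c * (sgn a * y) powr r = spow k r y"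
  proof -
    have "\<forall>\<^sub>F y in nhds a. y \<in> (if a > 0 then {0<..} else {..<0})"
      using False by (intro eventually_nhds_in_open) auto
    then show ?thesis
      by eventually_elim
        (use False assms in \<open>auto simp: c_def spow_def rpow_def sgn_if split: if_splits\<close>)
  qed
  ultimately show ?thesis
    using DERIV_cong_ev[of a a "\<lambda>y. c * (sgn a * y) powr r" "spow k r", OF refl _ refl] by simp
next
  case [simp]: True
  show ?thesis
  proof (cases "r = 1")
    case True
    then have "odd k" using sing by simp
    then have "spow k r = (\<lambda>y. y)"
      using True spow_odd_one by auto
    then show ?thesis
      using True \<open>odd k\<close> by (simp add: spow_even rpow_def)
  next
    case False
    then have r: "r > 1" using assms by simp
    have "((\<lambda>h. \<bar>h\<bar> powr (r - 1)) \<longlongrightarrow> 0) (at (0::real))"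
      using r by (auto intro!: tendsto_eq_intros simp: eventually_at_filter)
    then have "((\<lambda>h. spow k r h / h) \<longlongrightarrow> 0) (at 0)"
    proof (rule Lim_null_comparison[rotated])
      have "norm (spow k r h / h) \<le> \<bar>h\<bar> powr (r - 1)" for h
        using abs_spow_le[of k r h] r
        by (cases "h = 0") (auto simp: rpow_def powr_diff abs_divide intro: divide_right_mono)
      then show "\<forall>\<^sub>F h in at 0. norm (spow k r h / h) \<le> \<bar>h\<bar> powr (r - 1)"
        by simp
    qed
    moreover have "spow k r 0 = 0" "spow (Suc k) (r - 1) 0 = 0"
      using r by (auto simp: spow_def rpow_def)
    ultimately show ?thesis
      by (simp add: DERIV_def)
  qed
qed

text \<open>This bound gives the integrable majorant for differentiation under the expectation. The bound
uses a natural exponent \<open>m\<close> because the Gaussian field is controlled through its natural moments.\<close>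
lemma spow_lipschitz_on_interval:
  assumes "1 \<le> r" "r \<le> real m" "1 \<le> T" "\<bar>a\<bar> \<le> T" "\<bar>b\<bar> \<le> T"
  shows "\<bar>spow k r b - spow k r a\<bar> \<le> r * T ^ m * \<bar>b - a\<bar>"
proof (cases "r = 1")
  case True
  have "1 \<le> T ^ m" using assms by simp
  have "\<bar>spow k r b - spow k r a\<bar> \<le> 1 * \<bar>b - a\<bar>"
    using True by (cases "even k") (auto simp: spow_odd_one spow_even rpow_def)
  also have "\<dots> \<le> T ^ m * \<bar>b - a\<bar>"
    using \<open>1 \<le> T ^ m\<close> by (intro mult_right_mono) auto
  finally show ?thesis using True by simp
next
  case False
  have "norm (spow k r b - spow k r a) \<le> r * T ^ m * norm (b - a)"
  proof (rule field_differentiable_bound[where S = "{-T..T}" and f' = "\<lambda>z. r * spow (Suc k) (r - 1) z"])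
    show "(spow k r has_field_derivative r * spow (Suc k) (r - 1) z) (at z within {-T..T})" for z
      using False assms by (intro DERIV_subset[OF has_real_derivative_spow]) auto
    show "norm (r * spow (Suc k) (r - 1) z) \<le> r * T ^ m" if "z \<in> {-T..T}" for z
    proof -
      have "\<bar>spow (Suc k) (r - 1) z\<bar> \<le> T ^ m"
        using that assms by (intro order.trans[OF abs_spow_le rpow_le_power]) auto
      then show ?thesis
        using assms by (simp add: abs_mult mult_left_mono)
    qed
  qed (use assms in auto)
  then show ?thesis by simp
qed

text \<open>A number in \<open>[0, 1]\<close> is at most its \<open>\<nu>\<close>-th power; apply this to the shares \<open>a / (a + b)\<close> and
\<open>b / (a + b)\<close>, which add up to \<open>1\<close>.\<close>
lemma powr_subadditive:
  fixes a b :: real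
  assumes "0 \<le> a" "0 \<le> b" "0 < \<nu>" "\<nu> \<le> 1"
  shows "(a + b) powr \<nu> \<le> a powr \<nu> + b powr \<nu>"
proof (cases "a + b = 0")
  case False
  then have s: "a + b > 0" using assms by simp
  have le: "t \<le> t powr \<nu>" if "0 \<le> t" "t \<le> 1" for t
    using powr_mono'[of \<nu> 1 t] that assms by (cases "t = 0") auto
  have "1 = a / (a + b) + b / (a + b)"
    using s by (simp add: add_divide_distrib[symmetric])
  also have "\<dots> \<le> (a / (a + b)) powr \<nu> + (b / (a + b)) powr \<nu>"
    using s assms by (intro add_mono le) auto
  also have "\<dots> = (a powr \<nu> + b powr \<nu>) / (a + b) powr \<nu>"
    using s assms by (simp add: powr_divide add_divide_distrib)
  finally show ?thesis
    using s by (simp add: field_simps)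
qed (use assms in auto)

lemma abs_powr_diff_le:
  fixes a b :: real
  assumes "0 \<le> a" "0 \<le> b" "0 < \<nu>" "\<nu> \<le> 1"
  shows "\<bar>a powr \<nu> - b powr \<nu>\<bar> \<le> \<bar>a - b\<bar> powr \<nu>"
proof -
  show ?thesis
    using powr_subadditive[of a "b - a" \<nu>] powr_subadditive[of b "a - b" \<nu>] assms
      powr_mono2[of \<nu> a b] powr_mono2[of \<nu> b a]
    by (cases "a \<le> b") (auto simp: abs_if)
qed

text \<open>Concavity of the power: with \<open>s\<close> the mean of \<open>a\<close> and \<open>b\<close>, compare \<open>(a / s) powr \<nu>\<close> and
\<open>(b / s) powr \<nu>\<close> with the tangent at \<open>1\<close>.\<close>
lemma powr_sum_le:
  fixes a b :: real
  assumes "0 \<le> a" "0 \<le> b" "0 < \<nu>" "\<nu> \<le> 1"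
  shows "a powr \<nu> + b powr \<nu> \<le> 2 powr (1 - \<nu>) * (a + b) powr \<nu>"
proof (cases "a + b = 0")
  case False
  define s where "s = (a + b) / 2"
  have s: "s > 0" using False assms by (simp add: s_def)
  have tangent: "t powr \<nu> \<le> \<nu> * t + (1 - \<nu>)" if "0 \<le> t" for t
    using Youngs_inequality_0[of \<nu> "1 - \<nu>" t 1] that assms by (cases "t = 0") auto
  have "(a / s) powr \<nu> + (b / s) powr \<nu> \<le> (\<nu> * (a / s) + (1 - \<nu>)) + (\<nu> * (b / s) + (1 - \<nu>))"
    using s assms by (intro add_mono tangent) auto
  also have "\<dots> = \<nu> * ((a + b) / s) + 2 - 2 * \<nu>"
    by (simp add: add_divide_distrib algebra_simps)
  also have "(a + b) / s = 2"
    using False unfolding s_def by (simp add: divide_simps)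
  also have "\<nu> * 2 + 2 - 2 * \<nu> = 2"
    by simp
  finally have "a powr \<nu> + b powr \<nu> \<le> 2 * s powr \<nu>"
    using s assms by (simp add: powr_divide field_simps)
  also have "2 * s powr \<nu> = 2 powr (1 - \<nu>) * (a + b) powr \<nu>"
    using assms by (simp add: s_def powr_divide powr_diff)
  finally show ?thesis .
next
  case True
  then have "a = 0" "b = 0" using assms by auto
  then show ?thesis by simp
qed

text \<open>The factor \<open>2 powr (1 - \<nu>)\<close> is caused by arguments of opposite sign, for which the difference
of the odd powers is a sum of two powers.\<close>
lemma spow_holder:
  assumes "0 \<le> \<nu>" "\<nu> \<le> 1"
  shows "\<bar>spow k \<nu> a - spow k \<nu> b\<bar> \<le> (if odd k then 2 powr (1 - \<nu>) else 1) * rpow \<bar>a - b\<bar> \<nu>"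
proof (cases "\<nu> = 0")
  case True
  then show ?thesis by (simp add: spow_def rpow_def sgn_if)
next
  case False
  then have \<nu>: "0 < \<nu>" using assms by simp
  have two: "1 \<le> 2 powr (1 - \<nu>)"
    using assms by (simp add: ge_one_powr_ge_zero)
  have same: "\<bar>\<bar>a\<bar> powr \<nu> - \<bar>b\<bar> powr \<nu>\<bar> \<le> \<bar>a - b\<bar> powr \<nu>"
    by (rule order.trans[OF abs_powr_diff_le[OF _ _ \<nu> assms(2)]])
       (use \<nu> in \<open>auto intro: powr_mono2\<close>)
  also have "\<dots> \<le> 2 powr (1 - \<nu>) * \<bar>a - b\<bar> powr \<nu>"
    using two mult_right_mono[of 1 "2 powr (1 - \<nu>)" "\<bar>a - b\<bar> powr \<nu>"] by simp
  finally have same': "\<bar>\<bar>a\<bar> powr \<nu> - \<bar>b\<bar> powr \<nu>\<bar> \<le> 2 powr (1 - \<nu>) * \<bar>a - b\<bar> powr \<nu>" .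
  have opp: "\<bar>a\<bar> powr \<nu> + \<bar>b\<bar> powr \<nu> \<le> 2 powr (1 - \<nu>) * \<bar>a - b\<bar> powr \<nu>" if "a * b \<le> 0"
  proof -
    have "\<bar>a - b\<bar> = \<bar>a\<bar> + \<bar>b\<bar>"
      using that by (auto simp: mult_le_0_iff)
    then show ?thesis
      using powr_sum_le[of "\<bar>a\<bar>" "\<bar>b\<bar>" \<nu>] \<nu> assms by simp
  qed
  show ?thesis
  proof (cases "even k")
    case True
    then show ?thesis using same False by (simp add: spow_even rpow_def)
  next
    case odd: False
    show ?thesis
    proof (cases "a * b \<le> 0")
      case True
      have "\<bar>spow k \<nu> a - spow k \<nu> b\<bar> \<le> \<bar>a\<bar> powr \<nu> + \<bar>b\<bar> powr \<nu>"
        using False abs_spow_le[of k \<nu> a] abs_spow_le[of k \<nu> b] by (simp add: rpow_def)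
      then show ?thesis using opp[OF True] odd False by (simp add: rpow_def)
    next
      case pos: False
      then have "sgn a = sgn b" "\<bar>sgn b\<bar> = 1"
        by (auto simp: sgn_if mult_le_0_iff not_le)
      then have "\<bar>spow k \<nu> a - spow k \<nu> b\<bar> = \<bar>\<bar>a\<bar> powr \<nu> - \<bar>b\<bar> powr \<nu>\<bar>"
        using odd False by (simp add: spow_def rpow_def right_diff_distrib[symmetric] abs_mult)
      then show ?thesis using same' odd False by (simp add: rpow_def)
    qed
  qed
qed

text \<open>The inequality \<open>ln t \<le> t - 1\<close> for \<open>t = b powr q / S\<close>, added up over the list.\<close>
lemma ln_prod_list_le:
  fixes q S :: real
  assumes "\<forall>b\<in>set bs. 0 < b" "0 < S"
  shows "q * ln (prod_list bs) \<le>
    sum_list (map (\<lambda>b. b powr q) bs) / S + real (length bs) * (ln S - 1)"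
  using assms(1)
proof (induction bs)
  case (Cons b bs)
  have pos: "0 < prod_list bs" using Cons.prems by (induction bs) auto
  have "ln (b powr q / S) \<le> b powr q / S - 1"
    using Cons.prems assms(2) by (intro ln_le_minus_one) simp
  then have "q * ln b \<le> b powr q / S + (ln S - 1)"
    using Cons.prems assms(2) by (simp add: ln_div ln_powr)
  moreover have "q * ln (prod_list bs) \<le>
      sum_list (map (\<lambda>b. b powr q) bs) / S + real (length bs) * (ln S - 1)"
    using Cons by simp
  ultimately show ?case
    using Cons.prems pos by (simp add: ln_mult add_divide_distrib algebra_simps)
qed simp

text \<open>In this form with weights \<open>\<nu> / q, 1 / q, \<dots>, 1 / q\<close> the right-hand side involves only \<open>q\<close>-th powers,
whose expectations are known exactly for Gaussian variables.\<close>
lemma weighted_am_gm: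
  fixes a \<nu> q :: real
  assumes "0 \<le> a" "\<forall>b\<in>set bs. 0 \<le> b" "0 \<le> \<nu>" "q = real (length bs) + \<nu>" "0 < q"
  shows "rpow a \<nu> * prod_list bs \<le> (\<nu> * a powr q + sum_list (map (\<lambda>b. b powr q) bs)) / q"
    (is "_ \<le> ?S")
proof -
  have sum0: "0 \<le> sum_list (map (\<lambda>b. b powr q) bs)"
    by (intro sum_list_nonneg) auto
  have S0: "0 \<le> ?S"
    using assms sum0 by auto
  show ?thesis
  proof (cases "(a = 0 \<and> \<nu> \<noteq> 0) \<or> 0 \<in> set bs")
    case True
    then have "rpow a \<nu> * prod_list bs = 0"
      by (auto simp: rpow_def prod_list_zero_iff)
    then show ?thesis using S0 by (simp only:)
  next
    case False
    then have bs: "\<forall>b\<in>set bs. 0 < b" and a: "\<nu> \<noteq> 0 \<Longrightarrow> 0 < a"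
      using assms by (auto simp: order.strict_iff_order)
    have prod: "0 < prod_list bs" using bs by (induction bs) auto
    have "0 < \<nu> * a powr q + sum_list (map (\<lambda>b. b powr q) bs)"
    proof (cases "\<nu> = 0")
      case True
      then obtain b cs where "bs = b # cs" using assms by (cases bs) auto
      then show ?thesis using True bs by (auto intro!: add_pos_nonneg sum_list_nonneg)
    qed (use a assms sum0 in \<open>auto intro!: add_pos_nonneg\<close>)
    then have S: "0 < ?S" using assms by simp
    have "\<nu> * (q * ln a) \<le> \<nu> * (a powr q / ?S + (ln ?S - 1))"
    proof (cases "\<nu> = 0")
      case False
      have "ln (a powr q / ?S) \<le> a powr q / ?S - 1"
        using a[OF False] by (intro ln_le_minus_one divide_pos_pos S) auto
      moreover have "ln (a powr q / ?S) = q * ln a - ln ?S"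
        using a[OF False] S by (subst ln_div) (auto simp: ln_powr)
      ultimately show ?thesis using assms by (intro mult_left_mono) linarith+
    qed simp
    with ln_prod_list_le[OF bs S, of q]
    have "q * (\<nu> * ln a + ln (prod_list bs)) \<le>
      (\<nu> * a powr q + sum_list (map (\<lambda>b. b powr q) bs)) / ?S + q * (ln ?S - 1)"
      by (simp add: assms(4) algebra_simps add_divide_distrib)
    also have "(\<nu> * a powr q + sum_list (map (\<lambda>b. b powr q) bs)) / ?S = q"
      using S assms by (simp add: field_simps)
    finally have "q * (\<nu> * ln a + ln (prod_list bs)) \<le> q * ln ?S"
      by (simp add: algebra_simps)
    then have "\<nu> * ln a + ln (prod_list bs) \<le> ln ?S"
      using assms by (simp add: mult_le_cancel_left_pos)
    moreover have "ln (rpow a \<nu> * prod_list bs) = \<nu> * ln a + ln (prod_list bs)"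
      using a prod by (auto simp: rpow_def ln_mult ln_powr)
    moreover have "0 < rpow a \<nu> * prod_list bs"
      using a prod by (auto simp: rpow_def)
    ultimately show ?thesis
      using S by (metis ln_le_cancel_iff)
  qed
qed

section \<open>The norm as the scale of a Gaussian field\<close>

text \<open>Gram--Schmidt orthonormalization for the inner product \<open>B\<close>, one vector per induction step.\<close>
lemma posdef_orthonormal_extension:
  fixes B :: "'a::euclidean_space \<Rightarrow> ('a \<Rightarrow>\<^sub>L real)"
  assumes B: "selfadjoint_posdef B" and "finite S"
  shows "\<exists>E. finite E \<and> S \<subseteq> span E \<and>
    (\<forall>u\<in>E. \<forall>v\<in>E. blinfun_apply (B u) v = (if u = v then 1 else 0))"
  using \<open>finite S\<close>
proof (induction S rule: finite_induct)
  case empty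
  then show ?case by (intro exI[of _ "{}"]) auto
next
  case (insert a S)
  then obtain E where E: "finite E" "S \<subseteq> span E"
    "\<And>u v. u \<in> E \<Longrightarrow> v \<in> E \<Longrightarrow> blinfun_apply (B u) v = (if u = v then 1 else 0)"
    by blast
  have lin: "linear B" and sym: "\<And>x y. blinfun_apply (B x) y = blinfun_apply (B y) x"
    and pos: "\<And>x. x \<noteq> 0 \<Longrightarrow> blinfun_apply (B x) x > 0"
    using B by (auto simp: selfadjoint_posdef_def)
  define a' where "a' = a - (\<Sum>u\<in>E. blinfun_apply (B a) u *\<^sub>R u)"
  have proj: "(\<Sum>u\<in>E. blinfun_apply (B a) u *\<^sub>R u) \<in> span E"
    by (intro span_sum span_scale span_base)
  have orth: "blinfun_apply (B v) a' = 0" if "v \<in> E" for v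
  proof -
    have "blinfun_apply (B v) a' =
        blinfun_apply (B v) a - (\<Sum>u\<in>E. blinfun_apply (B a) u * blinfun_apply (B v) u)"
      by (simp add: a'_def blinfun.diff_right blinfun.sum_right blinfun.scaleR_right)
    also have "(\<Sum>u\<in>E. blinfun_apply (B a) u * blinfun_apply (B v) u)
        = (\<Sum>u\<in>E. if u = v then blinfun_apply (B a) v else 0)"
      using that by (intro sum.cong) (auto simp: E(3))
    also have "\<dots> = blinfun_apply (B v) a"
      using that E(1) sym by simp
    finally show ?thesis by simp
  qed
  show ?case
  proof (cases "a' = 0")
    case True
    then have "a \<in> span E" using proj by (simp add: a'_def)
    then show ?thesis using E by blast
  next
    case False
    define e where "e = (1 / enorm B a') *\<^sub>R a'"
    have na: "enorm B a' > 0"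
      using pos[OF False] by (simp add: enorm_def)
    have ee: "blinfun_apply (B e) e = 1"
      using pos[OF False] na
      by (simp add: e_def linear_cmul[OF lin] blinfun.scaleR_left blinfun.scaleR_right enorm_def)
    have ov: "blinfun_apply (B v) e = 0" "blinfun_apply (B e) v = 0" if "v \<in> E" for v
      using orth[OF that] sym[of e v] by (simp_all add: e_def blinfun.scaleR_right)
    have "e \<notin> E" using ov ee by force
    have "a = (\<Sum>u\<in>E. blinfun_apply (B a) u *\<^sub>R u) + enorm B a' *\<^sub>R e"
      using na by (simp add: e_def a'_def)
    moreover have "\<dots> \<in> span (insert e E)"
      using proj span_mono[of E "insert e E"]
      by (intro span_add span_scale) (auto intro: span_base)
    ultimately have "a \<in> span (insert e E)" by simp
    moreover have "S \<subseteq> span (insert e E)"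
      using E(2) span_mono[of E "insert e E"] by auto
    ultimately show ?thesis
      using E ee ov \<open>e \<notin> E\<close> by (intro exI[of _ "insert e E"]) auto
  qed
qed

lemma posdef_orthonormal_basis:
  fixes B :: "'a::euclidean_space \<Rightarrow> ('a \<Rightarrow>\<^sub>L real)"
  assumes B: "selfadjoint_posdef B"
  obtains E where "finite E" "E \<noteq> {}"
    "\<And>x. (\<Sum>u\<in>E. (blinfun_apply (B x) u)\<^sup>2) = (enorm B x)\<^sup>2"
proof -
  obtain E where E: "finite E" "Basis \<subseteq> span E"
    "\<And>u v. u \<in> E \<Longrightarrow> v \<in> E \<Longrightarrow> blinfun_apply (B u) v = (if u = v then 1 else 0)"
    using posdef_orthonormal_extension[OF B finite_Basis] by blast
  have lin: "linear B" and sym: "\<And>x y. blinfun_apply (B x) y = blinfun_apply (B y) x"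
    and pos: "\<And>x. x \<noteq> 0 \<Longrightarrow> blinfun_apply (B x) x > 0"
    using B by (auto simp: selfadjoint_posdef_def)
  have span: "span E = UNIV"
    using E(2) by (metis span_Basis span_span span_mono top.extremum_uniqueI)
  have "(\<Sum>u\<in>E. (blinfun_apply (B x) u)\<^sup>2) = (enorm B x)\<^sup>2" for x
  proof -
    have "x \<in> span E" using span by simp
    then obtain c where c: "x = (\<Sum>u\<in>E. c u *\<^sub>R u)"
      using E(1) by (auto simp: span_finite)
    have coef: "blinfun_apply (B x) v = c v" if "v \<in> E" for v
    proof -
      have "blinfun_apply (B x) v = (\<Sum>u\<in>E. c u * blinfun_apply (B u) v)"
        by (simp add: c linear_sum[OF lin] linear_cmul[OF lin] blinfun.sum_left blinfun.scaleR_left)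
      also have "\<dots> = (\<Sum>u\<in>E. if u = v then c v else 0)"
        using that by (intro sum.cong) (auto simp: E(3))
      finally show ?thesis using that E(1) by simp
    qed
    have "(\<Sum>u\<in>E. (blinfun_apply (B x) u)\<^sup>2) = (\<Sum>u\<in>E. c u * blinfun_apply (B x) u)"
      by (simp add: coef power2_eq_square)
    also have "\<dots> = blinfun_apply (B x) (\<Sum>u\<in>E. c u *\<^sub>R u)"
      by (simp add: blinfun.sum_right blinfun.scaleR_right)
    also have "\<dots> = blinfun_apply (B x) x"
      using c by simp
    also have "\<dots> = (enorm B x)\<^sup>2"
      using pos[of x] by (cases "x = 0") (auto simp: enorm_def linear_0[OF lin])
    finally show ?thesis .
  qed
  moreover have "E \<noteq> {}"
    using span by (metis span_empty UNIV_not_singleton)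
  ultimately show ?thesis using that E(1) by blast
qed

definition abs_moment :: "real \<Rightarrow> real" where
  "abs_moment q = (\<integral>y. std_normal_density y * rpow \<bar>y\<bar> q \<partial>lborel)"

text \<open>Positivity matters because the representation of the norm power divides by this moment.\<close>
lemma abs_moment_pos:
  assumes "0 \<le> q"
  shows "0 < abs_moment q"
proof -
  obtain m :: nat where m: "q \<le> real m" using real_arch_simple by blast
  have int: "integrable lborel (\<lambda>y. std_normal_density y * rpow \<bar>y\<bar> q)"
  proof (rule Bochner_Integration.integrable_bound)
    show "integrable lborel (\<lambda>y. std_normal_density y * \<bar>y\<bar> ^ 0 + std_normal_density y * \<bar>y\<bar> ^ m)"
      by (intro Bochner_Integration.integrable_add integrable_std_normal_moment_abs)
    have "rpow \<bar>y\<bar> q \<le> \<bar>y\<bar> ^ 0 + \<bar>y\<bar> ^ m" for y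
    proof (cases "\<bar>y\<bar> \<le> 1")
      case True
      then have "rpow \<bar>y\<bar> q \<le> 1 ^ m" using assms m by (intro rpow_le_power) auto
      then show ?thesis by (simp add: add_increasing2)
    next
      case False
      then have "rpow \<bar>y\<bar> q \<le> \<bar>y\<bar> ^ m" using assms m by (intro rpow_le_power) auto
      then show ?thesis by simp
    qed
    then show "AE y in lborel. norm (std_normal_density y * rpow \<bar>y\<bar> q) \<le>
        norm (std_normal_density y * \<bar>y\<bar> ^ 0 + std_normal_density y * \<bar>y\<bar> ^ m)"
      by (intro AE_I2) (simp add: distrib_left[symmetric] abs_mult rpow_nonneg mult_left_mono del: power_0)
  qed simp
  have "0 \<le> abs_moment q"
    unfolding abs_moment_def by (intro Bochner_Integration.integral_nonneg) (simp add: rpow_nonneg)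
  moreover have "abs_moment q \<noteq> 0"
  proof
    assume "abs_moment q = 0"
    then have "AE y in lborel. std_normal_density y * rpow \<bar>y\<bar> q = 0"
      using int unfolding abs_moment_def
      by (subst (asm) integral_nonneg_eq_0_iff_AE) (auto simp: rpow_nonneg)
    moreover have "AE y in lborel. y \<noteq> (0::real)"
      by (rule AE_lborel_singleton)
    ultimately have "AE y in (lborel :: real measure). False"
    proof eventually_elim
      case (elim y)
      then show ?case
        using normal_density_pos[of 1 0 y] by (auto simp: rpow_def split: if_splits)
    qed
    then show False
      by (simp add: ae_filter_eq_bot_iff trivial_limit_def[symmetric] eventually_False)
  qed
  ultimately show ?thesis by simp
qed

text \<open>A Gaussian field with covariance \<open>B\<close>, as a random linear functional. The random variable \<open>N\<close>
bounds the norm of the functional with respect to the norm of the type, in which derivatives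
are taken; since it is at least \<open>1\<close> and has all moments, powers of \<open>N\<close> serve as integrable
majorants.\<close>
locale gaussian_functional = prob_space M
  for M :: "'w measure" and B :: "'a::euclidean_space \<Rightarrow> ('a \<Rightarrow>\<^sub>L real)"
    and \<xi> :: "'a \<Rightarrow> 'w \<Rightarrow> real" and N :: "'w \<Rightarrow> real" +
  assumes posdef: "selfadjoint_posdef B"
    and measurable_\<xi> [measurable]: "\<And>x. \<xi> x \<in> borel_measurable M"
    and measurable_N [measurable]: "N \<in> borel_measurable M"
    and linear_\<xi>: "\<And>\<omega>. linear (\<lambda>x. \<xi> x \<omega>)"
    and N_ge_1: "\<And>\<omega>. 1 \<le> N \<omega>"
    and abs_\<xi>_le: "\<And>x \<omega>. \<bar>\<xi> x \<omega>\<bar> \<le> norm x * N \<omega>"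
    and integrable_N_power: "\<And>m. integrable M (\<lambda>\<omega>. N \<omega> ^ m)"
    and normal_\<xi>: "\<And>x. x \<noteq> 0 \<Longrightarrow> distributed M lborel (\<xi> x) (normal_density 0 (enorm B x))"

text \<open>The field is \<open>\<xi> x = \<Sum>\<^sub>u \<langle>B x, u\<rangle> \<omega>\<^sub>u\<close> with independent standard normal coordinates \<open>\<omega>\<^sub>u\<close> indexed
by an orthonormal basis for \<open>B\<close>; a sum of independent normal variables is normal, and its
variance is the sum of the squares of the coefficients, that is \<open>\<parallel>x\<parallel>\<^sup>2\<close>.\<close>
theorem gaussian_functional_exists:
  fixes B :: "'a::euclidean_space \<Rightarrow> ('a \<Rightarrow>\<^sub>L real)"
  assumes B: "selfadjoint_posdef B"
  obtains M :: "('a \<Rightarrow> real) measure" and \<xi> N where "gaussian_functional M B \<xi> N"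
proof -
  obtain E where E: "finite E" "E \<noteq> {}"
    "\<And>x. (\<Sum>u\<in>E. (blinfun_apply (B x) u)\<^sup>2) = (enorm B x)\<^sup>2"
    using posdef_orthonormal_basis[OF B] by blast
  have lin: "linear B" and pos: "\<And>x. x \<noteq> 0 \<Longrightarrow> blinfun_apply (B x) x > 0"
    using B by (auto simp: selfadjoint_posdef_def)
  define G :: "real measure" where "G = density lborel std_normal_density"
  have G: "prob_space G"
    unfolding G_def by (rule prob_space_normal_density) simp
  define M where "M = PiM E (\<lambda>_. G)"
  interpret prob_space M
    unfolding M_def by (rule prob_space_PiM) (rule G)
  have [measurable_cong, simp]: "sets G = sets borel" "space G = UNIV"
    by (auto simp: G_def)
  have meas: "(\<lambda>\<omega>. \<omega> u) \<in> borel_measurable M" if "u \<in> E" for u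
    unfolding M_def using measurable_component_singleton[OF that, of "\<lambda>_. G"]
    by (simp cong: measurable_cong_sets)
  have distr_u: "distr M borel (\<lambda>\<omega>. \<omega> u) = G" if "u \<in> E" for u
  proof -
    have "distr M borel (\<lambda>\<omega>. \<omega> u) = distr M G (\<lambda>\<omega>. \<omega> u)"
      by (rule distr_cong) auto
    also have "\<dots> = G"
      unfolding M_def by (rule distr_PiM_component) (use that E G in auto)
    finally show ?thesis .
  qed
  have normal_u: "distributed M lborel (\<lambda>\<omega>. \<omega> u) std_normal_density" if "u \<in> E" for u
    unfolding distributed_def
  proof (intro conjI)
    have "distr M lborel (\<lambda>\<omega>. \<omega> u) = distr M borel (\<lambda>\<omega>. \<omega> u)"
      by (rule distr_cong) auto
    then show "distr M lborel (\<lambda>\<omega>. \<omega> u) = density lborel std_normal_density"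
      using distr_u[OF that] by (simp add: G_def)
  qed (use meas[OF that] in auto)
  have indep: "indep_vars (\<lambda>_. borel) (\<lambda>u \<omega>. \<omega> u) E"
  proof (subst indep_vars_iff_distr_eq_PiM'[OF E(2)])
    have "distr M (\<Pi>\<^sub>M i\<in>E. borel) (\<lambda>\<omega>. \<lambda>u\<in>E. \<omega> u) = distr M M (\<lambda>\<omega>. \<omega>)"
      by (rule distr_cong) (auto simp: M_def space_PiM intro!: sets_PiM_cong)
    also have "\<dots> = PiM E (\<lambda>u. distr M borel (\<lambda>\<omega>. \<omega> u))"
      using distr_u unfolding distr_id2[OF refl] by (subst M_def) (auto intro!: PiM_cong)
    finally show "distr M (\<Pi>\<^sub>M i\<in>E. borel) (\<lambda>\<omega>. \<lambda>u\<in>E. \<omega> u)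
        = PiM E (\<lambda>u. distr M borel (\<lambda>\<omega>. \<omega> u))" .
  qed (use meas in auto)
  define \<xi> where "\<xi> x \<omega> = (\<Sum>u\<in>E. blinfun_apply (B x) u * \<omega> u)" for x :: 'a and \<omega> :: "'a \<Rightarrow> real"
  obtain K where K: "\<And>x. norm (B x) \<le> norm x * K" "K > 0"
    using linear_conv_bounded_linear[of B] lin bounded_linear.pos_bounded by blast
  define N where "N \<omega> = 1 + (\<Sum>u\<in>E. K * norm u * \<bar>\<omega> u\<bar>)" for \<omega> :: "'a \<Rightarrow> real"
  show ?thesis
  proof (rule that, rule gaussian_functional.intro[OF prob_space_axioms], rule gaussian_functional_axioms.intro)
    show "selfadjoint_posdef B" by (rule B)
    show [measurable]: "\<xi> x \<in> borel_measurable M" for x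
      unfolding \<xi>_def[abs_def] using meas by measurable
    show [measurable]: "N \<in> borel_measurable M"
      unfolding N_def[abs_def] using meas by measurable
    show "linear (\<lambda>x. \<xi> x \<omega>)" for \<omega>
      by (rule linearI) (simp_all add: \<xi>_def linear_add[OF lin] linear_cmul[OF lin]
          blinfun.add_left blinfun.scaleR_left sum.distrib sum_distrib_left algebra_simps)
    show "1 \<le> N \<omega>" for \<omega>
      using K(2) by (auto simp: N_def intro!: sum_nonneg)
    show "\<bar>\<xi> x \<omega>\<bar> \<le> norm x * N \<omega>" for x \<omega>
    proof -
      have "\<bar>\<xi> x \<omega>\<bar> \<le> (\<Sum>u\<in>E. norm x * (K * norm u * \<bar>\<omega> u\<bar>))"
        unfolding \<xi>_def
      proof (rule order.trans[OF sum_abs sum_mono])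
        fix u
        have "\<bar>blinfun_apply (B x) u\<bar> \<le> norm (B x) * norm u"
          using norm_blinfun[of "B x" u] by simp
        also have "\<dots> \<le> norm x * K * norm u"
          using K by (intro mult_right_mono) auto
        finally show "\<bar>blinfun_apply (B x) u * \<omega> u\<bar> \<le> norm x * (K * norm u * \<bar>\<omega> u\<bar>)"
          by (simp add: abs_mult mult_right_mono mult.assoc[symmetric])
      qed
      also have "\<dots> \<le> norm x * N \<omega>"
        by (simp add: N_def sum_distrib_left distrib_left)
      finally show ?thesis .
    qed
    have int_u: "integrable M (\<lambda>\<omega>. \<bar>\<omega> u\<bar> ^ m)" if "u \<in> E" for u m
      using distributed_integrable[OF normal_u[OF that], of "\<lambda>y. \<bar>y\<bar> ^ m"]
        integrable_std_normal_moment_abs[of m] by simp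
    show "integrable M (\<lambda>\<omega>. N \<omega> ^ m)" for m
    proof (rule Bochner_Integration.integrable_bound)
      let ?w = "\<lambda>\<omega> u. (1 + real (card E) * (K * norm u * \<bar>\<omega> u\<bar>)) ^ m"
      show "integrable M (\<lambda>\<omega>. \<Sum>u\<in>E. ?w \<omega> u)"
      proof (rule Bochner_Integration.integrable_sum)
        fix u assume u: "u \<in> E"
        let ?c = "real (card E) * (K * norm u)"
        have "integrable M (\<lambda>\<omega>. \<Sum>k\<le>m. of_nat (m choose k) * ?c ^ k * \<bar>\<omega> u\<bar> ^ k)"
          by (intro Bochner_Integration.integrable_sum integrable_mult_right int_u u)
        also have "(\<lambda>\<omega>. \<Sum>k\<le>m. of_nat (m choose k) * ?c ^ k * \<bar>\<omega> u\<bar> ^ k) = (\<lambda>\<omega>. ?w \<omega> u)"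
        proof
          fix \<omega>
          show "(\<Sum>k\<le>m. of_nat (m choose k) * ?c ^ k * \<bar>\<omega> u\<bar> ^ k) = ?w \<omega> u"
            using binomial_ring[of "?c * \<bar>\<omega> u\<bar>" 1 m]
            by (simp add: power_mult_distrib algebra_simps)
        qed
        finally show "integrable M (\<lambda>\<omega>. ?w \<omega> u)" .
      qed
      show "AE \<omega> in M. norm (N \<omega> ^ m) \<le> norm (\<Sum>u\<in>E. ?w \<omega> u)"
      proof (rule AE_I2)
        fix \<omega>
        let ?c = "\<lambda>u::'a. K * norm u * \<bar>\<omega> u\<bar>"
        obtain v where v: "v \<in> E" "\<And>u. u \<in> E \<Longrightarrow> ?c u \<le> ?c v"
        proof -
          have "Max (?c ` E) \<in> ?c ` E" using E by (intro Max_in) auto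
          then obtain v where "v \<in> E" "Max (?c ` E) = ?c v" by (rule imageE)
          moreover have "?c u \<le> Max (?c ` E)" if "u \<in> E" for u
            using E(1) that by (intro Max_ge) auto
          ultimately show ?thesis using that by metis
        qed
        have c0: "0 \<le> ?c u" for u using K by simp
        have "0 \<le> N \<omega>" using c0 by (auto simp: N_def intro!: add_nonneg_nonneg sum_nonneg)
        moreover have "N \<omega> \<le> 1 + real (card E) * ?c v"
          using sum_bounded_above[of E ?c "?c v"] v by (simp add: N_def)
        ultimately have "N \<omega> ^ m \<le> ?w \<omega> v"
          by (intro power_mono) auto
        also have "\<dots> \<le> (\<Sum>u\<in>E. ?w \<omega> u)"
          using v(1) E(1) c0 by (intro member_le_sum) auto
        finally show "norm (N \<omega> ^ m) \<le> norm (\<Sum>u\<in>E. ?w \<omega> u)"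
          using \<open>0 \<le> N \<omega>\<close> by simp
      qed
    qed measurable
    show "distributed M lborel (\<xi> x) (normal_density 0 (enorm B x))" if "x \<noteq> 0" for x
    proof -
      let ?b = "\<lambda>u. blinfun_apply (B x) u"
      \<comment> \<open>Normal laws need a positive standard deviation, so the vanishing summands are dropped.\<close>
      define I where "I = {u\<in>E. ?b u \<noteq> 0}"
      have I: "finite I" "I \<subseteq> E" using E by (auto simp: I_def)
      have sq: "(\<Sum>u\<in>I. \<bar>?b u\<bar>\<^sup>2) = (enorm B x)\<^sup>2"
        using E(1) unfolding E(3)[symmetric] I_def by (intro sum.mono_neutral_cong_left) auto
      have ex: "enorm B x > 0" using pos[OF that] by (simp add: enorm_def)
      then have "I \<noteq> {}" using sq by auto
      have "distributed M lborel (\<lambda>\<omega>. \<Sum>u\<in>I. ?b u * \<omega> u)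
          (normal_density (\<Sum>u\<in>I. 0) (sqrt (\<Sum>u\<in>I. \<bar>?b u\<bar>\<^sup>2)))"
      proof (rule sum_indep_normal[OF I(1) \<open>I \<noteq> {}\<close>])
        have "indep_vars (\<lambda>_. borel) (\<lambda>u \<omega>. \<omega> u) I"
          using indep_vars_subset[OF indep I(2)] .
        then show "indep_vars (\<lambda>_. borel) (\<lambda>u \<omega>. ?b u * \<omega> u) I"
          by (rule indep_vars_compose2) measurable
        fix u assume u: "u \<in> I"
        then show "0 < \<bar>?b u\<bar>" by (simp add: I_def)
        show "distributed M lborel (\<lambda>\<omega>. ?b u * \<omega> u) (normal_density 0 \<bar>?b u\<bar>)"
          using normal_density_affine[OF normal_u, of u "?b u" 0] u by (simp add: I_def)
      qed
      moreover have "(\<lambda>\<omega>. \<Sum>u\<in>I. ?b u * \<omega> u) = \<xi> x"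
        using E(1) unfolding \<xi>_def[abs_def] I_def by (intro ext sum.mono_neutral_left) auto
      moreover have "sqrt (\<Sum>u\<in>I. \<bar>?b u\<bar>\<^sup>2) = enorm B x"
        unfolding sq using ex by simp
      ultimately show ?thesis by simp
    qed
  qed
qed

section \<open>Differentiation under the expectation\<close>

context gaussian_functional
begin

lemma \<xi>_add: "\<xi> (x + y) \<omega> = \<xi> x \<omega> + \<xi> y \<omega>"
  using linear_add[OF linear_\<xi>] .

lemma \<xi>_scaleR: "\<xi> (c *\<^sub>R x) \<omega> = c * \<xi> x \<omega>"
  using linear_cmul[OF linear_\<xi>] by simp

lemma \<xi>_diff: "\<xi> (x - y) \<omega> = \<xi> x \<omega> - \<xi> y \<omega>"
  using linear_diff[OF linear_\<xi>] .

lemma \<xi>_zero [simp]: "\<xi> 0 \<omega> = 0"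
  using linear_0[OF linear_\<xi>] .

lemma \<xi>_minus: "\<xi> (- x) \<omega> = - \<xi> x \<omega>"
  using linear_neg[OF linear_\<xi>] .

lemma bounded_linear_\<xi>: "bounded_linear (\<lambda>x. \<xi> x \<omega>)"
  using linear_\<xi> linear_conv_bounded_linear by blast

lemma AE_\<xi>_nonzero:
  assumes "x \<noteq> 0"
  shows "AE \<omega> in M. \<xi> x \<omega> \<noteq> 0"
proof -
  have "AE y in lborel. y \<noteq> (0::real)"
    by (rule AE_lborel_singleton)
  then show ?thesis
    using distributed_AE2[OF normal_\<xi>[OF assms], of "\<lambda>y. y \<noteq> 0"] by auto
qed

lemma weight_bound: "\<bar>prod_list (map (\<lambda>h. \<xi> h \<omega>) hs)\<bar> \<le> prod_list (map norm hs) * N \<omega> ^ length hs"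
proof (induction hs)
  case (Cons h hs)
  have "\<bar>\<xi> h \<omega>\<bar> * \<bar>prod_list (map (\<lambda>h. \<xi> h \<omega>) hs)\<bar>
      \<le> (norm h * N \<omega>) * (prod_list (map norm hs) * N \<omega> ^ length hs)"
    using Cons abs_\<xi>_le[of h \<omega>] N_ge_1[of \<omega>] by (intro mult_mono) auto
  then show ?case by (simp add: abs_mult algebra_simps)
qed simp

lemma measurable_weight [measurable]:
  "(\<lambda>\<omega>. prod_list (map (\<lambda>h. \<xi> h \<omega>) hs)) \<in> borel_measurable M"
  by (induction hs) auto

lemma integrable_spow_weight:
  assumes "0 \<le> r"
  shows "integrable M (\<lambda>\<omega>. spow k r (\<xi> x \<omega>) * prod_list (map (\<lambda>h. \<xi> h \<omega>) hs))"
proof -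
  obtain m :: nat where m: "r \<le> real m" using real_arch_simple by blast
  let ?R = "norm x + 1"
  let ?P = "prod_list (map norm hs)"
  have P: "0 \<le> ?P" by (induction hs) auto
  show ?thesis
  proof (rule Bochner_Integration.integrable_bound)
    show "integrable M (\<lambda>\<omega>. ?R ^ m * ?P * N \<omega> ^ (m + length hs))"
      by (intro integrable_mult_right integrable_N_power)
    show "AE \<omega> in M. norm (spow k r (\<xi> x \<omega>) * prod_list (map (\<lambda>h. \<xi> h \<omega>) hs))
        \<le> norm (?R ^ m * ?P * N \<omega> ^ (m + length hs))"
    proof (rule AE_I2)
      fix \<omega>
      have N: "1 \<le> N \<omega>" by (rule N_ge_1)
      have R: "1 \<le> ?R * N \<omega>" using N mult_mono[of 1 ?R 1 "N \<omega>"] by simp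
      have "\<bar>\<xi> x \<omega>\<bar> \<le> ?R * N \<omega>"
        using abs_\<xi>_le[of x \<omega>] N by (simp add: algebra_simps)
      then have "\<bar>spow k r (\<xi> x \<omega>)\<bar> \<le> (?R * N \<omega>) ^ m"
        using assms m R by (intro order.trans[OF abs_spow_le rpow_le_power]) auto
      then have "\<bar>spow k r (\<xi> x \<omega>)\<bar> * \<bar>prod_list (map (\<lambda>h. \<xi> h \<omega>) hs)\<bar>
          \<le> (?R * N \<omega>) ^ m * (?P * N \<omega> ^ length hs)"
        using weight_bound R by (intro mult_mono) auto
      also have "\<dots> = ?R ^ m * ?P * N \<omega> ^ (m + length hs)"
        by (simp add: power_mult_distrib power_add mult_ac)
      finally show "norm (spow k r (\<xi> x \<omega>) * prod_list (map (\<lambda>h. \<xi> h \<omega>) hs))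
        \<le> norm (?R ^ m * ?P * N \<omega> ^ (m + length hs))"
        using N P by (simp add: abs_mult)
    qed
  qed measurable
qed

text \<open>Scaling \<open>\<xi> x\<close> by \<open>1 / \<parallel>x\<parallel>\<close> gives a standard normal variable.\<close>
lemma expectation_abs_\<xi>_power:
  assumes "0 \<le> q"
  shows "expectation (\<lambda>\<omega>. rpow \<bar>\<xi> x \<omega>\<bar> q) = abs_moment q * rpow (enorm B x) q"
proof (cases "x = 0")
  case True
  have "(\<integral>y. std_normal_density y \<partial>lborel) = 1"
    using integral_std_normal_moment_even[of 0] by simp
  then have "abs_moment 0 = 1"
    by (simp add: abs_moment_def rpow_def)
  then show ?thesis
    using True posdef assms
    by (cases "q = 0") (auto simp: rpow_def enorm_def selfadjoint_posdef_def prob_space)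
next
  case False
  define s where "s = enorm B x"
  have s: "0 < s"
    using False posdef by (auto simp: s_def enorm_def selfadjoint_posdef_def)
  have std: "distributed M lborel (\<lambda>\<omega>. (\<xi> x \<omega> - 0) / s) std_normal_density"
    using normal_standard_normal_convert[OF s, of "\<xi> x" 0] normal_\<xi>[OF False] by (simp add: s_def)
  have "abs_moment q = expectation (\<lambda>\<omega>. rpow \<bar>(\<xi> x \<omega> - 0) / s\<bar> q)"
    unfolding abs_moment_def by (rule distributed_integral[OF std]) auto
  also have "(\<lambda>\<omega>. rpow \<bar>(\<xi> x \<omega> - 0) / s\<bar> q) = (\<lambda>\<omega>. rpow (1 / s) q * rpow \<bar>\<xi> x \<omega>\<bar> q)"
    using s by (simp add: fun_eq_iff rpow_mult[symmetric])
  finally have "abs_moment q * rpow s q = (rpow (1 / s) q * rpow s q) * expectation (\<lambda>\<omega>. rpow \<bar>\<xi> x \<omega>\<bar> q)"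
    by simp
  also have "rpow (1 / s) q * rpow s q = 1"
    using s by (simp add: rpow_mult[symmetric])
  finally show ?thesis by (simp add: s_def)
qed

text \<open>Dominated convergence for the remainder of the first-order expansion divided by \<open>norm h\<close>. For
\<open>r = 1\<close> and even \<open>k\<close> the integrand is not differentiable where \<open>\<xi> x = 0\<close>, but this is a null
set unless \<open>x = 0\<close>.\<close>
lemma has_derivative_expectation_spow:
  assumes r: "1 \<le> r" and sing: "r = 1 \<Longrightarrow> odd k \<or> x \<noteq> 0"
  shows "((\<lambda>y. expectation (\<lambda>\<omega>. spow k r (\<xi> y \<omega>) * prod_list (map (\<lambda>h. \<xi> h \<omega>) hs))) has_derivative
    (\<lambda>h. r * expectation (\<lambda>\<omega>. spow (Suc k) (r - 1) (\<xi> x \<omega>) * prod_list (map (\<lambda>h. \<xi> h \<omega>) (h # hs))))) (at x)"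
proof -
  define W where "W \<omega> = prod_list (map (\<lambda>h. \<xi> h \<omega>) hs)" for \<omega>
  define D where "D h \<omega> = r * spow (Suc k) (r - 1) (\<xi> x \<omega>) * \<xi> h \<omega>" for h \<omega>
  define Q where "Q h \<omega> = (spow k r (\<xi> (x + h) \<omega>) - spow k r (\<xi> x \<omega>) - D h \<omega>) / norm h * W \<omega>" for h \<omega>
  have [measurable]: "W \<in> borel_measurable M" "D h \<in> borel_measurable M" for h
    unfolding W_def[abs_def] D_def[abs_def] by measurable
  have int: "integrable M (\<lambda>\<omega>. spow k r (\<xi> y \<omega>) * W \<omega>)" for y
    unfolding W_def using r by (intro integrable_spow_weight) auto
  have intD: "integrable M (\<lambda>\<omega>. D h \<omega> * W \<omega>)" for h
    using integrable_mult_right[OF integrable_spow_weight[of "r - 1" "Suc k" x "h # hs"], of r] r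
    by (simp add: D_def W_def mult.assoc)
  have D_eq: "r * expectation (\<lambda>\<omega>. spow (Suc k) (r - 1) (\<xi> x \<omega>) * prod_list (map (\<lambda>h. \<xi> h \<omega>) (h # hs)))
      = expectation (\<lambda>\<omega>. D h \<omega> * W \<omega>)" for h
    by (subst integral_mult_right_zero[symmetric]) (simp add: D_def W_def mult.assoc)
  obtain m :: nat where m: "r \<le> real m" using real_arch_simple by blast
  define P where "P = prod_list (map norm hs)"
  have P: "0 \<le> P" unfolding P_def by (induction hs) auto
  have "((\<lambda>y. expectation (\<lambda>\<omega>. spow k r (\<xi> y \<omega>) * W \<omega>)) has_derivative
      (\<lambda>h. expectation (\<lambda>\<omega>. D h \<omega> * W \<omega>))) (at x)"
    unfolding has_derivative_at
  proof (intro conjI)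
    have "linear (\<lambda>h. expectation (\<lambda>\<omega>. D h \<omega> * W \<omega>))"
    proof (rule linearI)
      fix u v
      have "expectation (\<lambda>\<omega>. D (u + v) \<omega> * W \<omega>) = expectation (\<lambda>\<omega>. D u \<omega> * W \<omega> + D v \<omega> * W \<omega>)"
        by (simp add: D_def \<xi>_add algebra_simps)
      then show "expectation (\<lambda>\<omega>. D (u + v) \<omega> * W \<omega>)
          = expectation (\<lambda>\<omega>. D u \<omega> * W \<omega>) + expectation (\<lambda>\<omega>. D v \<omega> * W \<omega>)"
        using intD by simp
    next
      fix c u
      have "expectation (\<lambda>\<omega>. D (c *\<^sub>R u) \<omega> * W \<omega>) = expectation (\<lambda>\<omega>. c * (D u \<omega> * W \<omega>))"
        by (simp add: D_def \<xi>_scaleR algebra_simps)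
      then show "expectation (\<lambda>\<omega>. D (c *\<^sub>R u) \<omega> * W \<omega>) = c *\<^sub>R expectation (\<lambda>\<omega>. D u \<omega> * W \<omega>)"
        by simp
    qed
    then show "bounded_linear (\<lambda>h. expectation (\<lambda>\<omega>. D h \<omega> * W \<omega>))"
      by (simp add: linear_conv_bounded_linear)
    have quot: "(expectation (\<lambda>\<omega>. spow k r (\<xi> (x + h) \<omega>) * W \<omega>) - expectation (\<lambda>\<omega>. spow k r (\<xi> x \<omega>) * W \<omega>)
        - expectation (\<lambda>\<omega>. D h \<omega> * W \<omega>)) / norm h = expectation (Q h)" for h
    proof -
      have "Q h = (\<lambda>\<omega>. (spow k r (\<xi> (x + h) \<omega>) * W \<omega> - spow k r (\<xi> x \<omega>) * W \<omega> - D h \<omega> * W \<omega>) / norm h)"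
        by (simp add: fun_eq_iff Q_def left_diff_distrib diff_divide_distrib)
      then show ?thesis using int intD by simp
    qed
    have "((\<lambda>h. expectation (Q h)) \<longlongrightarrow> 0) (at 0)"
      unfolding tendsto_at_iff_sequentially o_def
    proof (intro allI impI)
      fix X :: "nat \<Rightarrow> 'a" assume X: "\<forall>i. X i \<in> UNIV - {0}" "X \<longlonglongrightarrow> 0"
      then have ne: "X i \<noteq> 0" for i by auto
      \<comment> \<open>The majorant has to be the same for the whole sequence of increments.\<close>
      obtain R0 where R0: "\<And>i. norm (X i) \<le> R0"
        using convergent_imp_Bseq[of X] X(2) unfolding Bseq_def convergent_def by blast
      define R where "R = norm x + R0 + 1"
      have R0nn: "0 \<le> R0" using R0[of 0] norm_ge_zero order_trans by blast
      have bound: "norm (Q (X i) \<omega>) \<le> 2 * r * R ^ m * P * N \<omega> ^ (m + 1 + length hs)" for i \<omega>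
      proof -
        have N: "1 \<le> N \<omega>" by (rule N_ge_1)
        have R1: "1 \<le> R" using R0nn by (simp add: R_def)
        then have T: "1 \<le> R * N \<omega>" using N mult_mono[of 1 R 1 "N \<omega>"] by simp
        have a: "\<bar>\<xi> x \<omega>\<bar> \<le> R * N \<omega>"
          by (rule order.trans[OF abs_\<xi>_le mult_right_mono]) (use N R0nn in \<open>auto simp: R_def\<close>)
        have "norm (x + X i) \<le> R"
          using norm_triangle_ineq[of x "X i"] R0[of i] by (simp add: R_def)
        then have b: "\<bar>\<xi> (x + X i) \<omega>\<bar> \<le> R * N \<omega>"
          by (intro order.trans[OF abs_\<xi>_le mult_right_mono]) (use N in auto)
        have X_le: "\<bar>\<xi> (X i) \<omega>\<bar> \<le> norm (X i) * N \<omega>" by (rule abs_\<xi>_le)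
        have "\<bar>spow k r (\<xi> (x + X i) \<omega>) - spow k r (\<xi> x \<omega>)\<bar> \<le> r * (R * N \<omega>) ^ m * \<bar>\<xi> (X i) \<omega>\<bar>"
          using spow_lipschitz_on_interval[OF r m T a b, of k] by (simp add: \<xi>_add)
        moreover have "\<bar>spow (Suc k) (r - 1) (\<xi> x \<omega>)\<bar> \<le> (R * N \<omega>) ^ m"
          using a T r m by (intro order.trans[OF abs_spow_le rpow_le_power]) auto
        then have "\<bar>D (X i) \<omega>\<bar> \<le> r * (R * N \<omega>) ^ m * \<bar>\<xi> (X i) \<omega>\<bar>"
          using r by (auto simp: D_def abs_mult intro!: mult_right_mono mult_left_mono)
        ultimately have "\<bar>spow k r (\<xi> (x + X i) \<omega>) - spow k r (\<xi> x \<omega>) - D (X i) \<omega>\<bar>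
            \<le> 2 * r * (R * N \<omega>) ^ m * \<bar>\<xi> (X i) \<omega>\<bar>"
          by linarith
        also have "\<dots> \<le> 2 * r * (R * N \<omega>) ^ m * (norm (X i) * N \<omega>)"
          using r T X_le by (intro mult_left_mono) auto
        finally have "\<bar>spow k r (\<xi> (x + X i) \<omega>) - spow k r (\<xi> x \<omega>) - D (X i) \<omega>\<bar> / norm (X i)
            \<le> 2 * r * (R * N \<omega>) ^ m * N \<omega>"
          using ne[of i] by (simp add: field_simps)
        then have "\<bar>spow k r (\<xi> (x + X i) \<omega>) - spow k r (\<xi> x \<omega>) - D (X i) \<omega>\<bar> / norm (X i) * \<bar>W \<omega>\<bar>
            \<le> (2 * r * (R * N \<omega>) ^ m * N \<omega>) * (P * N \<omega> ^ length hs)"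
          unfolding W_def P_def using r T N by (intro mult_mono weight_bound) auto
        then show ?thesis
          by (simp add: Q_def abs_mult power_mult_distrib power_add mult_ac)
      qed
      have "(\<lambda>i. expectation (Q (X i))) \<longlonglongrightarrow> expectation (\<lambda>_. 0)"
      proof (rule integral_dominated_convergence)
        show "integrable M (\<lambda>\<omega>. 2 * r * R ^ m * P * N \<omega> ^ (m + 1 + length hs))"
          by (intro integrable_mult_right integrable_N_power)
        show "AE \<omega> in M. norm (Q (X i) \<omega>) \<le> 2 * r * R ^ m * P * N \<omega> ^ (m + 1 + length hs)" for i
          using bound by simp
        have lim: "(\<lambda>i. Q (X i) \<omega>) \<longlonglongrightarrow> 0" if "r = 1 \<Longrightarrow> odd k \<or> \<xi> x \<omega> \<noteq> 0" for \<omega>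
        proof -
          have "(spow k r has_derivative (\<lambda>t. r * spow (Suc k) (r - 1) (\<xi> x \<omega>) * t)) (at (\<xi> x \<omega>))"
            using has_real_derivative_spow[OF r that] by (simp add: has_field_derivative_def)
          from has_derivative_compose[OF bounded_linear_imp_has_derivative[OF bounded_linear_\<xi>] this]
          have "((\<lambda>y. spow k r (\<xi> y \<omega>)) has_derivative (\<lambda>h. D h \<omega>)) (at x)"
            by (simp add: D_def)
          then have "((\<lambda>h. norm (spow k r (\<xi> (x + h) \<omega>) - spow k r (\<xi> x \<omega>) - D h \<omega>) / norm h) \<longlongrightarrow> 0) (at 0)"
            by (simp add: has_derivative_at)
          then have "(\<lambda>i. norm (spow k r (\<xi> (x + X i) \<omega>) - spow k r (\<xi> x \<omega>) - D (X i) \<omega>) / norm (X i)) \<longlonglongrightarrow> 0"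
            using X unfolding tendsto_at_iff_sequentially o_def by blast
          then have "(\<lambda>i. norm ((spow k r (\<xi> (x + X i) \<omega>) - spow k r (\<xi> x \<omega>) - D (X i) \<omega>) / norm (X i))) \<longlonglongrightarrow> 0"
            by simp
          then have "(\<lambda>i. (spow k r (\<xi> (x + X i) \<omega>) - spow k r (\<xi> x \<omega>) - D (X i) \<omega>) / norm (X i)) \<longlonglongrightarrow> 0"
            by (rule tendsto_norm_zero_cancel)
          then have "(\<lambda>i. (spow k r (\<xi> (x + X i) \<omega>) - spow k r (\<xi> x \<omega>) - D (X i) \<omega>) / norm (X i) * W \<omega>) \<longlonglongrightarrow> 0 * W \<omega>"
            by (intro tendsto_mult tendsto_const)
          then show ?thesis by (simp add: Q_def)
        qed
        show "AE \<omega> in M. (\<lambda>i. Q (X i) \<omega>) \<longlonglongrightarrow> 0"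
        proof (cases "x = 0")
          case True
          then show ?thesis using lim sing by auto
        next
          case False
          show ?thesis using AE_\<xi>_nonzero[OF False] by eventually_elim (auto intro: lim)
        qed
        show "Q (X i) \<in> borel_measurable M" for i
          unfolding Q_def[abs_def] by measurable
      qed simp
      then show "(\<lambda>i. expectation (Q (X i))) \<longlonglongrightarrow> 0" by simp
    qed
    then have "((\<lambda>h. (expectation (\<lambda>\<omega>. spow k r (\<xi> (x + h) \<omega>) * W \<omega>) - expectation (\<lambda>\<omega>. spow k r (\<xi> x \<omega>) * W \<omega>)
        - expectation (\<lambda>\<omega>. D h \<omega> * W \<omega>)) / norm h) \<longlongrightarrow> 0) (at 0)"
      by (simp only: quot)
    from tendsto_norm_zero[OF this]
    show "(\<lambda>h. norm (expectation (\<lambda>\<omega>. spow k r (\<xi> (x + h) \<omega>) * W \<omega>) - expectation (\<lambda>\<omega>. spow k r (\<xi> x \<omega>) * W \<omega>)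
        - expectation (\<lambda>\<omega>. D h \<omega> * W \<omega>)) / norm h) \<midarrow>0\<rightarrow> 0"
      by simp
  qed
  then show ?thesis
    unfolding D_eq by (simp only: W_def)
qed

end

section \<open>Derivatives of powers of the norm\<close>

lemma prod_diff_eq_prod_add:
  "(\<Prod>j<p. (real p + \<nu>) - real j) = (\<Prod>i=1..p. \<nu> + real i)"
proof -
  have "(\<Prod>j<p. (real p + \<nu>) - real j) = (\<Prod>j<p. \<nu> + real (p - j))"
    by (intro prod.cong) (auto simp: of_nat_diff)
  also have "\<dots> = (\<Prod>i=1..p. \<nu> + real i)"
    by (rule prod.reindex_bij_witness[of _ "\<lambda>i. p - i" "\<lambda>j. p - j"]) auto
  finally show ?thesis .
qed

context gaussian_functional
begin

text \<open>The candidate for the \<open>k\<close>-th derivative of \<open>\<parallel>x\<parallel>\<^sup>q\<close>: the \<open>k\<close>-th derivative of \<open>\<bar>\<xi> x\<bar>\<^sup>q / m\<^sub>q\<close>, taken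
under the expectation.\<close>
definition deriv_form :: "real \<Rightarrow> nat \<Rightarrow> 'a \<Rightarrow> 'a list \<Rightarrow> real" where
  "deriv_form q k x hs = (\<Prod>j<k. q - real j) / abs_moment q *
     expectation (\<lambda>\<omega>. spow k (q - real k) (\<xi> x \<omega>) * prod_list (map (\<lambda>h. \<xi> h \<omega>) hs))"

lemma norm_power_eq_deriv_form:
  assumes "0 \<le> q"
  shows "norm_power B q x = deriv_form q 0 x []"
  using expectation_abs_\<xi>_power[OF assms, of x] abs_moment_pos[OF assms]
  by (simp add: deriv_form_def spow_even norm_power_def)

lemma has_derivative_deriv_form:
  assumes "1 \<le> q - real k" "q - real k = 1 \<Longrightarrow> odd k \<or> x \<noteq> 0"
  shows "((\<lambda>y. deriv_form q k y hs) has_derivative (\<lambda>h. deriv_form q (Suc k) x (h # hs))) (at x)"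
proof -
  let ?c = "(\<Prod>j<k. q - real j) / abs_moment q"
  have "((\<lambda>y. deriv_form q k y hs) has_derivative (\<lambda>h. ?c * ((q - real k) *
      expectation (\<lambda>\<omega>. spow (Suc k) (q - real k - 1) (\<xi> x \<omega>) * prod_list (map (\<lambda>h. \<xi> h \<omega>) (h # hs)))))) (at x)"
    unfolding deriv_form_def
    by (intro has_derivative_mult_right has_derivative_expectation_spow assms)
  moreover have "?c * ((q - real k) * expectation (\<lambda>\<omega>. spow (Suc k) (q - real k - 1) (\<xi> x \<omega>) *
      prod_list (map (\<lambda>h. \<xi> h \<omega>) (h # hs)))) = deriv_form q (Suc k) x (h # hs)" for h
  proof -
    have "q - real k - 1 = q - real (Suc k)" by simp
    then show ?thesis by (simp only: deriv_form_def prod.lessThan_Suc) (simp only: mult_ac times_divide_eq_left times_divide_eq_right)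
  qed
  ultimately show ?thesis by simp
qed

text \<open>The exponent \<open>q - k\<close> is at least \<open>1\<close> before each of the first \<open>p\<close> differentiations, and equals
\<open>1\<close> only before the last one with \<open>\<nu> = 0\<close>. Hence the origin is exceptional only for \<open>k = p\<close>.\<close>
lemma nth_frechet_norm_power:
  assumes \<nu>: "0 \<le> \<nu>" and "k \<le> p"
    and "k = p \<Longrightarrow> \<not> (odd p \<and> \<nu> = 0 \<and> x = 0)"
  shows "nth_differentiable_at k (norm_power B (real p + \<nu>)) x \<and>
    (\<forall>hs. length hs = k \<longrightarrow> nth_frechet k (norm_power B (real p + \<nu>)) x hs = deriv_form (real p + \<nu>) k x hs)"
  using assms(2,3)
proof (induction k arbitrary: x)
  case 0
  then show ?case using norm_power_eq_deriv_form[of "real p + \<nu>"] \<nu> by simp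
next
  case (Suc k)
  let ?f = "norm_power B (real p + \<nu>)" and ?q = "real p + \<nu>"
  have IH: "nth_differentiable_at k ?f y"
    "\<And>hs. length hs = k \<Longrightarrow> nth_frechet k ?f y hs = deriv_form ?q k y hs" for y
    using Suc.IH[of y] Suc.prems(1) by auto
  have der: "((\<lambda>y. nth_frechet k ?f y hs) has_derivative (\<lambda>h. deriv_form ?q (Suc k) x (h # hs))) (at x)"
    if "length hs = k" for hs
  proof -
    have "1 \<le> ?q - real k" using Suc.prems(1) \<nu> by simp
    moreover have "odd k \<or> x \<noteq> 0" if "?q - real k = 1"
    proof -
      have "\<nu> = 0" "Suc k = p" using that Suc.prems(1) \<nu> by linarith+
      then show ?thesis using Suc.prems(2) by auto
    qed
    ultimately show ?thesis
      unfolding IH(2)[OF that] by (rule has_derivative_deriv_form)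
  qed
  have "nth_frechet (Suc k) ?f x hs = deriv_form ?q (Suc k) x hs" if len: "length hs = Suc k" for hs
  proof -
    obtain h hs' where hs: "hs = h # hs'" "length hs' = k"
      using len by (auto simp: length_Suc_conv)
    show ?thesis
      using frechet_derivative_at[OF der[OF hs(2)]] hs by (simp add: fun_eq_iff)
  qed
  moreover have "(\<lambda>y. nth_frechet k ?f y hs) differentiable (at x)" if "length hs = k" for hs
    using der[OF that] by (auto simp: differentiable_def)
  ultimately show ?case
    using IH(1) by simp
qed

text \<open>The formula extends to the exceptional case \<open>p\<close> odd, \<open>\<nu> = 0\<close>, \<open>x = 0\<close>, where the derivative is
zero by convention and the right-hand side is zero because \<open>sgn 0 = 0\<close>.\<close>
lemma nth_derivative_norm_power:
  assumes \<nu>: "0 \<le> \<nu>" and hs: "length hs = p"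
  shows "nth_derivative p (norm_power B (real p + \<nu>)) x hs = deriv_form (real p + \<nu>) p x hs"
proof (cases "odd p \<and> \<nu> = 0 \<and> x = 0")
  case False
  then show ?thesis
    using nth_frechet_norm_power[OF \<nu>, of p p x] hs by (simp add: nth_derivative_def)
next
  case True
  let ?f = "norm_power B (real p + \<nu>)" and ?q = "real p + \<nu>"
  have zero: "deriv_form ?q p x hs = 0"
    using True by (simp add: deriv_form_def spow_def)
  show ?thesis
  proof (cases "nth_differentiable_at p ?f x")
    case diff: True
    \<comment> \<open>If the form of the previous order is differentiable at the origin at all, its derivative
    there is zero, because that form is an even function of the point.\<close>
    obtain k where p: "p = Suc k"
      using True by (cases p) auto
    then obtain h hs' where k: "p = Suc k" "hs = h # hs'" "length hs' = k"
      using hs by (auto simp: length_Suc_conv)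
    have eq: "(\<lambda>y. nth_frechet k ?f y hs') = (\<lambda>y. deriv_form ?q k y hs')"
      using nth_frechet_norm_power[OF \<nu>, of k p] k by auto
    have "(\<lambda>y. nth_frechet k ?f y hs') differentiable (at x)"
      using diff k by simp
    then obtain D where D: "((\<lambda>y. deriv_form ?q k y hs') has_derivative D) (at 0)"
      unfolding eq using True by (auto simp: differentiable_def)
    have "((\<lambda>y. deriv_form ?q k (- y) hs') has_derivative (\<lambda>h. D (- h))) (at 0)"
      by (rule has_derivative_compose[where f = uminus])
        (use D in \<open>auto intro!: derivative_eq_intros\<close>)
    moreover have "deriv_form ?q k (- y) hs' = deriv_form ?q k y hs'" for y
      using True k by (simp add: deriv_form_def \<xi>_minus spow_minus)
    ultimately have "((\<lambda>y. deriv_form ?q k y hs') has_derivative (\<lambda>h. D (- h))) (at 0)"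
      by simp
    then have "D = (\<lambda>h. D (- h))"
      by (rule has_derivative_unique[OF D])
    moreover have "D (- h) = - D h"
      using linear_neg[OF has_derivative_linear[OF D]] .
    ultimately have "D h = - D h"
      using fun_cong[of D "\<lambda>h. D (- h)" h] by (simp only:)
    then have "D h = 0" by simp
    moreover have "nth_frechet p ?f x hs = D h"
      using frechet_derivative_at[OF D] eq k True by simp
    ultimately show ?thesis
      using zero diff by (simp add: nth_derivative_def)
  qed (simp add: nth_derivative_def zero)
qed

lemma expectation_sum_list:
  assumes "\<And>h. h \<in> set hs \<Longrightarrow> integrable M (f h) \<and> expectation (f h) = m"
  shows "integrable M (\<lambda>\<omega>. sum_list (map (\<lambda>h. f h \<omega>) hs))
    \<and> expectation (\<lambda>\<omega>. sum_list (map (\<lambda>h. f h \<omega>) hs)) = real (length hs) * m"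
  using assms
proof (induction hs)
  case (Cons h hs)
  then show ?case by (simp add: algebra_simps)
qed simp

lemma abs_weight: "\<bar>prod_list (map (\<lambda>h. \<xi> h \<omega>) hs)\<bar> = prod_list (map (\<lambda>h. \<bar>\<xi> h \<omega>\<bar>) hs)"
  by (induction hs) (auto simp: abs_mult)

lemma integrable_mixed_moment:
  assumes "0 \<le> \<nu>"
  shows "integrable M (\<lambda>\<omega>. rpow \<bar>\<xi> e \<omega>\<bar> \<nu> * prod_list (map (\<lambda>h. \<bar>\<xi> h \<omega>\<bar>) hs))"
  using integrable_norm[OF integrable_spow_weight[OF assms, of 0 e hs]]
  by (simp add: spow_even abs_mult abs_weight rpow_nonneg)

text \<open>By the weighted inequality of means the integrand is at most a convex combination of \<open>q\<close>-th
powers of standard normal variables. For \<open>\<nu> = 0\<close> the variable \<open>\<xi> e\<close> has weight zero, so \<open>e\<close> may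
be arbitrary.\<close>
lemma expectation_mixed_moment_unit_le:
  assumes \<nu>: "0 \<le> \<nu>" and unit: "\<forall>h\<in>set hs. enorm B h = 1"
    and e: "\<nu> = 0 \<or> enorm B e = 1" and q: "q = real (length hs) + \<nu>" "0 < q"
  shows "expectation (\<lambda>\<omega>. rpow \<bar>\<xi> e \<omega>\<bar> \<nu> * prod_list (map (\<lambda>h. \<bar>\<xi> h \<omega>\<bar>) hs)) \<le> abs_moment q"
proof -
  have r: "rpow a q = a powr q" for a using q(2) by (simp add: rpow_def)
  define P where "P h \<omega> = \<bar>\<xi> h \<omega>\<bar> powr q" for h \<omega>
  have mom: "integrable M (P x)"
    "expectation (P x) = abs_moment q * enorm B x powr q" for x
    using integrable_mixed_moment[OF less_imp_le[OF q(2)], of x "[]"]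
      expectation_abs_\<xi>_power[OF less_imp_le[OF q(2)], of x]
    unfolding r P_def[abs_def] by simp_all
  define S where "S \<omega> = (\<nu> * P e \<omega> + sum_list (map (\<lambda>h. P h \<omega>) hs)) / q" for \<omega>
  have le: "rpow \<bar>\<xi> e \<omega>\<bar> \<nu> * prod_list (map (\<lambda>h. \<bar>\<xi> h \<omega>\<bar>) hs) \<le> S \<omega>" for \<omega>
  proof -
    have "rpow \<bar>\<xi> e \<omega>\<bar> \<nu> * prod_list (map (\<lambda>h. \<bar>\<xi> h \<omega>\<bar>) hs) \<le> (\<nu> * \<bar>\<xi> e \<omega>\<bar> powr q
        + sum_list (map (\<lambda>b. b powr q) (map (\<lambda>h. \<bar>\<xi> h \<omega>\<bar>) hs))) / q"
    proof (rule weighted_am_gm)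
      show "q = real (length (map (\<lambda>h. \<bar>\<xi> h \<omega>\<bar>) hs)) + \<nu>"
        unfolding length_map by (rule q(1))
    qed (simp_all add: \<nu> q(2))
    then show ?thesis
      by (simp only: S_def P_def map_map o_def)
  qed
  have sum: "integrable M (\<lambda>\<omega>. sum_list (map (\<lambda>h. P h \<omega>) hs))
    \<and> expectation (\<lambda>\<omega>. sum_list (map (\<lambda>h. P h \<omega>) hs)) = real (length hs) * abs_moment q"
    by (rule expectation_sum_list) (use mom unit in auto)
  have intS: "integrable M S"
    unfolding S_def[abs_def]
    by (intro integrable_divide Bochner_Integration.integrable_add integrable_mult_right mom conjunct1[OF sum])
  have "expectation S = (\<nu> * (abs_moment q * enorm B e powr q) + real (length hs) * abs_moment q) / q"
    unfolding S_def[abs_def] using sum mom by simp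
  also have "\<dots> = (q * abs_moment q) / q"
    using e by (auto simp: q algebra_simps)
  also have "\<dots> = abs_moment q" using q by simp
  finally show ?thesis
    using integral_mono[OF integrable_mixed_moment[OF \<nu>] intS le] by (simp only:)
qed

lemma expectation_mixed_moment_le:
  assumes \<nu>: "0 \<le> \<nu>" and unit: "\<forall>h\<in>set hs. enorm B h = 1"
  shows "expectation (\<lambda>\<omega>. rpow \<bar>\<xi> d \<omega>\<bar> \<nu> * prod_list (map (\<lambda>h. \<bar>\<xi> h \<omega>\<bar>) hs))
    \<le> abs_moment (real (length hs) + \<nu>) * rpow (enorm B d) \<nu>"
proof (cases "hs = []")
  case True
  then show ?thesis using expectation_abs_\<xi>_power[OF \<nu>] by simp
next
  case ne: False
  define q where "q = real (length hs) + \<nu>"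
  have q: "0 < q" using ne \<nu> by (simp add: q_def add_pos_nonneg)
  note unit_case = expectation_mixed_moment_unit_le[OF \<nu> unit _ q_def q]
  show ?thesis
  proof (cases "\<nu> = 0")
    case True
    then show ?thesis using unit_case[of d] by (simp add: q_def rpow_def)
  next
    case False
    show ?thesis
    proof (cases "d = 0")
      case True
      then show ?thesis
        using False posdef by (simp add: rpow_def enorm_def selfadjoint_posdef_def linear_0)
    next
      case d: False
      define e where "e = (1 / enorm B d) *\<^sub>R d"
      have lin: "linear B" and ed: "0 < enorm B d"
        using posdef d by (auto simp: selfadjoint_posdef_def enorm_def)
      have "enorm B e = sqrt ((1 / enorm B d) * (1 / enorm B d) * (enorm B d)\<^sup>2)"
        using ed by (simp add: e_def enorm_def linear_cmul[OF lin] blinfun.scaleR_left blinfun.scaleR_right)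
      also have "\<dots> = 1"
        using ed by (simp add: power2_eq_square)
      finally have e1: "enorm B e = 1" .
      have "\<xi> d \<omega> = enorm B d * \<xi> e \<omega>" for \<omega>
        using ed by (simp add: e_def \<xi>_scaleR)
      then have "expectation (\<lambda>\<omega>. rpow \<bar>\<xi> d \<omega>\<bar> \<nu> * prod_list (map (\<lambda>h. \<bar>\<xi> h \<omega>\<bar>) hs))
          = expectation (\<lambda>\<omega>. rpow (enorm B d) \<nu> * (rpow \<bar>\<xi> e \<omega>\<bar> \<nu> * prod_list (map (\<lambda>h. \<bar>\<xi> h \<omega>\<bar>) hs)))"
        using ed by (simp add: abs_mult rpow_mult mult.assoc)
      also have "\<dots> = rpow (enorm B d) \<nu> * expectation (\<lambda>\<omega>. rpow \<bar>\<xi> e \<omega>\<bar> \<nu> * prod_list (map (\<lambda>h. \<bar>\<xi> h \<omega>\<bar>) hs))"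
        by (rule integral_mult_right_zero)
      also have "\<dots> \<le> rpow (enorm B d) \<nu> * abs_moment q"
        using unit_case[of e] e1 by (intro mult_left_mono rpow_nonneg) auto
      finally show ?thesis by (simp add: q_def mult.commute)
    qed
  qed
qed

text \<open>The one-dimensional Hoelder estimate inside the expectation, with \<open>\<xi> x - \<xi> y = \<xi> (x - y)\<close>,
followed by the bound for the mixed moment; the factor \<open>m\<^sub>q\<close> cancels.\<close>
lemma deriv_form_diff_le:
  assumes \<nu>: "0 \<le> \<nu>" "\<nu> \<le> 1"
    and hs: "length hs = p" "\<forall>h\<in>set hs. enorm B h = 1"
  shows "\<bar>deriv_form (real p + \<nu>) p x hs - deriv_form (real p + \<nu>) p y hs\<bar>
    \<le> (if odd p then 2 powr (1 - \<nu>) else 1) * (\<Prod>i=1..p. \<nu> + real i) * rpow (enorm B (x - y)) \<nu>"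
proof -
  let ?q = "real p + \<nu>"
  let ?K = "if odd p then 2 powr (1 - \<nu>) else 1 :: real"
  let ?C = "\<Prod>i=1..p. \<nu> + real i"
  let ?W = "\<lambda>\<omega>. prod_list (map (\<lambda>h. \<xi> h \<omega>) hs)"
  let ?A = "\<lambda>\<omega>. prod_list (map (\<lambda>h. \<bar>\<xi> h \<omega>\<bar>) hs)"
  have m: "0 < abs_moment ?q" using \<nu> by (intro abs_moment_pos) auto
  have C: "0 \<le> ?C" using \<nu> by (intro prod_nonneg) auto
  note absW = abs_weight
  have int: "integrable M (\<lambda>\<omega>. spow p \<nu> (\<xi> z \<omega>) * ?W \<omega>)" for z
    using \<nu> by (intro integrable_spow_weight)
  have intd: "integrable M (\<lambda>\<omega>. ?K * (rpow \<bar>\<xi> (x - y) \<omega>\<bar> \<nu> * ?A \<omega>))"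
    by (intro integrable_mult_right integrable_mixed_moment \<nu>)
  have "deriv_form ?q p x hs - deriv_form ?q p y hs
      = ?C / abs_moment ?q * expectation (\<lambda>\<omega>. spow p \<nu> (\<xi> x \<omega>) * ?W \<omega> - spow p \<nu> (\<xi> y \<omega>) * ?W \<omega>)"
    using int by (simp add: deriv_form_def prod_diff_eq_prod_add right_diff_distrib)
  then have "\<bar>deriv_form ?q p x hs - deriv_form ?q p y hs\<bar>
      = ?C / abs_moment ?q * \<bar>expectation (\<lambda>\<omega>. spow p \<nu> (\<xi> x \<omega>) * ?W \<omega> - spow p \<nu> (\<xi> y \<omega>) * ?W \<omega>)\<bar>"
    using m C by (simp add: abs_mult)
  also have "\<dots> \<le> ?C / abs_moment ?q * (?K * (abs_moment ?q * rpow (enorm B (x - y)) \<nu>))"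
  proof (intro mult_left_mono)
    have "\<bar>expectation (\<lambda>\<omega>. spow p \<nu> (\<xi> x \<omega>) * ?W \<omega> - spow p \<nu> (\<xi> y \<omega>) * ?W \<omega>)\<bar>
        \<le> expectation (\<lambda>\<omega>. \<bar>spow p \<nu> (\<xi> x \<omega>) * ?W \<omega> - spow p \<nu> (\<xi> y \<omega>) * ?W \<omega>\<bar>)"
      by (rule integral_abs_bound)
    also have "\<dots> \<le> expectation (\<lambda>\<omega>. ?K * (rpow \<bar>\<xi> (x - y) \<omega>\<bar> \<nu> * ?A \<omega>))"
    proof (rule integral_mono[OF _ intd])
      show "integrable M (\<lambda>\<omega>. \<bar>spow p \<nu> (\<xi> x \<omega>) * ?W \<omega> - spow p \<nu> (\<xi> y \<omega>) * ?W \<omega>\<bar>)"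
        using int by (intro integrable_abs Bochner_Integration.integrable_diff)
      show "\<bar>spow p \<nu> (\<xi> x \<omega>) * ?W \<omega> - spow p \<nu> (\<xi> y \<omega>) * ?W \<omega>\<bar>
          \<le> ?K * (rpow \<bar>\<xi> (x - y) \<omega>\<bar> \<nu> * ?A \<omega>)" for \<omega>
        using mult_right_mono[OF spow_holder[OF \<nu>, of p "\<xi> x \<omega>" "\<xi> y \<omega>"] abs_ge_zero[of "?W \<omega>"]]
        by (simp add: left_diff_distrib[symmetric] abs_mult absW \<xi>_diff mult.assoc)
    qed
    also have "\<dots> = ?K * expectation (\<lambda>\<omega>. rpow \<bar>\<xi> (x - y) \<omega>\<bar> \<nu> * ?A \<omega>)"
      by (rule integral_mult_right_zero)
    also have "\<dots> \<le> ?K * (abs_moment ?q * rpow (enorm B (x - y)) \<nu>)"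
      using expectation_mixed_moment_le[OF \<nu>(1) hs(2), of "x - y"] hs(1)
      by (intro mult_left_mono) auto
    finally show "\<bar>expectation (\<lambda>\<omega>. spow p \<nu> (\<xi> x \<omega>) * ?W \<omega> - spow p \<nu> (\<xi> y \<omega>) * ?W \<omega>)\<bar>
      \<le> ?K * (abs_moment ?q * rpow (enorm B (x - y)) \<nu>)" .
  qed (use m C in auto)
  also have "\<dots> = ?K * ?C * rpow (enorm B (x - y)) \<nu>"
    using m by (simp add: field_simps)
  finally show ?thesis .
qed

end

lemma exists_enorm_1:
  fixes B :: "'a::euclidean_space \<Rightarrow> ('a \<Rightarrow>\<^sub>L real)"
  assumes "selfadjoint_posdef B"
  shows "\<exists>e. enorm B e = 1"
proof -
  obtain b :: 'a where "b \<in> Basis" using nonempty_Basis by blast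
  then have "b \<noteq> 0" by auto
  then have lin: "linear B" and eb: "0 < enorm B b"
    using assms by (auto simp: selfadjoint_posdef_def enorm_def)
  have "enorm B ((1 / enorm B b) *\<^sub>R b) = 1"
    using eb by (simp add: enorm_def linear_cmul[OF lin] blinfun.scaleR_left blinfun.scaleR_right)
  then show ?thesis ..
qed

lemma form_norm_le:
  assumes B: "selfadjoint_posdef B"
    and "\<And>hs. length hs = p \<Longrightarrow> \<forall>h\<in>set hs. enorm B h = 1 \<Longrightarrow> \<bar>L hs\<bar> \<le> C"
  shows "form_norm B p L \<le> C"
proof -
  obtain e where "enorm B e = 1" using exists_enorm_1[OF B] by blast
  then have "length (replicate p e) = p \<and> (\<forall>h\<in>set (replicate p e). enorm B h = 1)" by simp
  then have "{\<bar>L hs\<bar> |hs. length hs = p \<and> (\<forall>h\<in>set hs. enorm B h = 1)} \<noteq> {}" by blast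
  then show ?thesis
    unfolding form_norm_def by (rule cSup_least) (use assms(2) in auto)
qed

text \<open>The lower bound for \<open>C\<close> is itself an admissible constant; it is kept apart from \<open>C\<close> so that both
constants of the final statement are covered by comparing them with it.\<close>
theorem form_holder_norm_power:
  fixes B :: "'a::euclidean_space \<Rightarrow> ('a \<Rightarrow>\<^sub>L real)"
  assumes B: "selfadjoint_posdef B" and \<nu>: "0 \<le> \<nu>" "\<nu> \<le> 1"
    and C: "(if odd p then 2 powr (1 - \<nu>) else 1) * (\<Prod>i=1..p. \<nu> + real i) \<le> C"
  shows "form_holder B p \<nu> C (nth_derivative p (norm_power B (real p + \<nu>)))"
proof -
  obtain M :: "('a \<Rightarrow> real) measure" and \<xi> N where "gaussian_functional M B \<xi> N"
    using gaussian_functional_exists[OF B] .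
  then interpret gaussian_functional M B \<xi> N .
  show ?thesis
    unfolding form_holder_def
  proof (intro allI form_norm_le[OF B])
    fix x1 x2 and hs :: "'a list"
    assume hs: "length hs = p" "\<forall>h\<in>set hs. enorm B h = 1"
    show "\<bar>nth_derivative p (norm_power B (real p + \<nu>)) x2 hs
      - nth_derivative p (norm_power B (real p + \<nu>)) x1 hs\<bar> \<le> C * rpow (enorm B (x2 - x1)) \<nu>"
      unfolding nth_derivative_norm_power[OF \<nu>(1) hs(1)]
      by (rule order.trans[OF deriv_form_diff_le[OF \<nu> hs] mult_right_mono[OF C rpow_nonneg]])
  qed
qed

section \<open>Endpoint values of the polynomials \<open>g\<close>\<close>

lemma poly_gpoly_1: "poly (gpoly p q) 1 = (\<Prod>j<p. q - real j)"
  by (induction p) (simp_all add: algebra_simps)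

text \<open>The recursion defining \<open>gpoly\<close> involves a derivative, which leaves the value at \<open>0\<close> open. This
recurrence without derivatives, the analogue of the one for Gegenbauer polynomials, closes it:
at \<open>0\<close> it links every second polynomial.\<close>
lemma gpoly_three_term:
  "gpoly (Suc (Suc k)) q
    = smult (real (Suc k) * (q - real k)) (gpoly k q) + [:0, q - 2 * real (Suc k):] * gpoly (Suc k) q"
proof (induction k)
  case 0
  show ?case
    by (simp add: pderiv_pCons pderiv_mult algebra_simps)
next
  case (Suc k)
  have "poly (gpoly (Suc (Suc (Suc k))) q) t = poly (smult (real (Suc (Suc k)) * (q - real (Suc k))) (gpoly (Suc k) q)
      + [:0, q - 2 * real (Suc (Suc k)):] * gpoly (Suc (Suc k)) q) t" for t
  proof -
    define a a' where "a = poly (gpoly k q) t" and "a' = poly (pderiv (gpoly k q)) t"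
    define b b' where "b = poly (gpoly (Suc k) q) t" and "b' = poly (pderiv (gpoly (Suc k) q)) t"
    define d d' where "d = poly (gpoly (Suc (Suc k)) q) t" and "d' = poly (pderiv (gpoly (Suc (Suc k)) q)) t"
    note defs = a_def a'_def b_def b'_def d_def d'_def
    have rec: "poly (gpoly (Suc n) q) t = (1 - t\<^sup>2) * poly (pderiv (gpoly n q)) t + (q - real n) * t * poly (gpoly n q) t" for n
      by (simp add: algebra_simps power2_eq_square)
    have 1: "b = (1 - t\<^sup>2) * a' + (q - real k) * t * a"
      unfolding defs by (rule rec)
    have 2: "d = (1 - t\<^sup>2) * b' + (q - real (Suc k)) * t * b"
      unfolding defs by (rule rec)
    have 3: "d = real (Suc k) * (q - real k) * a + (q - 2 * real (Suc k)) * t * b"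
      unfolding defs Suc.IH by (simp add: algebra_simps del: gpoly.simps)
    have 4: "d' = real (Suc k) * (q - real k) * a' + (q - 2 * real (Suc k)) * (b + t * b')"
      unfolding defs Suc.IH by (simp add: pderiv_add pderiv_smult pderiv_mult pderiv_pCons algebra_simps del: gpoly.simps)
    have "(1 - t\<^sup>2) * d' + (q - real (Suc (Suc k))) * t * d
        = real (Suc (Suc k)) * (q - real (Suc k)) * b + (q - 2 * real (Suc (Suc k))) * t * d"
    proof -
      have "(1 - t\<^sup>2) * d' = real (Suc k) * (q - real k) * ((1 - t\<^sup>2) * a')
          + (q - 2 * real (Suc k)) * ((1 - t\<^sup>2) * b + t * ((1 - t\<^sup>2) * b'))"
        unfolding 4 by (simp add: algebra_simps)
      also have "(1 - t\<^sup>2) * a' = b - (q - real k) * t * a" using 1 by simp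
      also have "(1 - t\<^sup>2) * b' = d - (q - real (Suc k)) * t * b" using 2 by simp
      finally show ?thesis
        unfolding 3 by (simp add: algebra_simps power2_eq_square)
    qed
    then show ?thesis
      unfolding rec[of "Suc (Suc k)"] by (simp add: defs[symmetric] algebra_simps del: gpoly.simps)
  qed
  then show ?case by (simp only: poly_eq_poly_eq_iff[symmetric] fun_eq_iff) simp
qed

lemma poly_gpoly_even_0:
  "poly (gpoly (2 * m) q) 0 = (\<Prod>i<m. (2 * real i + 1) * (q - 2 * real i))"
proof (induction m)
  case (Suc m)
  have "poly (gpoly (Suc (Suc (2 * m))) q) 0 = (2 * real m + 1) * (q - 2 * real m) * poly (gpoly (2 * m) q) 0"
    unfolding gpoly_three_term by (simp add: algebra_simps)
  then show ?case using Suc by (simp del: gpoly.simps)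
qed simp

lemma double_fact_odd: "double_fact (2 * int m - 1) = (\<Prod>i<m. 2 * int i + 1)"
  unfolding double_fact_def
  by (rule prod.reindex_bij_witness[of _ "\<lambda>i. 2 * int i + 1" "\<lambda>i. nat ((i - 1) div 2)"])
     (auto elim!: oddE)

lemma poly_gpoly_even_0_double_fact:
  "poly (gpoly (2 * m) (real (2 * m) + \<nu>)) 0
    = of_int (double_fact (int (2 * m) - 1)) * (\<Prod>i=1..m. \<nu> + 2 * real i)"
proof -
  have "(\<Prod>i<m. (real (2 * m) + \<nu>) - 2 * real i) = (\<Prod>i<m. \<nu> + 2 * real (m - i))"
    by (intro prod.cong) (auto simp: of_nat_diff)
  also have "\<dots> = (\<Prod>i=1..m. \<nu> + 2 * real i)"
    by (rule prod.reindex_bij_witness[of _ "\<lambda>i. m - i" "\<lambda>j. m - j"]) auto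
  finally show ?thesis
    using double_fact_odd[of m] by (simp add: poly_gpoly_even_0 prod.distrib)
qed

text \<open>The right-hand side is a supremum, so besides taking the quotient at \<open>0\<close> and \<open>1\<close> one has to see
that the quotients are bounded; a Lipschitz constant of the polynomial on \<open>[0, 1]\<close> is a bound,
as \<open>t \<le> t powr \<nu>\<close> there.\<close>
lemma H_const_ge:
  assumes "0 \<le> \<nu>" "\<nu> \<le> 1"
  shows "poly (gpoly p (real p + \<nu>)) 1 - poly (gpoly p (real p + \<nu>)) 0 \<le> H_const p \<nu>"
proof -
  let ?g = "gpoly p (real p + \<nu>)"
  let ?S = "{(poly ?g \<tau>2 - poly ?g \<tau>1) / rpow (\<tau>2 - \<tau>1) \<nu>
          |\<tau>1 \<tau>2. 0 \<le> \<tau>1 \<and> \<tau>1 < \<tau>2 \<and> \<tau>2 \<le> 1}"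
  have "compact ((\<lambda>t. poly (pderiv ?g) t) ` {0..1})"
    by (intro compact_continuous_image continuous_intros) auto
  then obtain K where K: "K > 0" "\<And>t. t \<in> {0..1} \<Longrightarrow> \<bar>poly (pderiv ?g) t\<bar> \<le> K"
    using compact_imp_bounded bounded_pos by (metis image_eqI real_norm_def)
  have "z \<le> K" if "z \<in> ?S" for z
  proof -
    from that obtain s t where st: "0 \<le> s" "s < t" "t \<le> 1" "z = (poly ?g t - poly ?g s) / rpow (t - s) \<nu>"
      by blast
    have "norm (poly ?g t - poly ?g s) \<le> K * norm (t - s)"
      by (rule field_differentiable_bound[where S = "{0..1}" and f' = "poly (pderiv ?g)"])
        (use st K in \<open>auto intro: DERIV_subset[OF poly_DERIV]\<close>)
    moreover have "t - s \<le> rpow (t - s) \<nu>"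
      using powr_mono'[of \<nu> 1 "t - s"] st assms by (auto simp: rpow_def)
    then have "K * (t - s) \<le> K * rpow (t - s) \<nu>" using K by simp
    ultimately have "poly ?g t - poly ?g s \<le> K * rpow (t - s) \<nu>" using st by auto
    moreover have "0 < rpow (t - s) \<nu>" using st by (simp add: rpow_def)
    ultimately show "z \<le> K" using st by (simp add: divide_le_eq)
  qed
  then have "bdd_above ?S" by (rule bdd_aboveI)
  moreover have "poly ?g 1 - poly ?g 0 \<in> ?S"
    by (rule CollectI, rule exI[of _ 0], rule exI[of _ 1]) (simp add: rpow_def)
  ultimately show ?thesis
    unfolding H_const_def by (rule cSup_upper[rotated])
qed

section \<open>Hoelder continuity of the derivatives\<close>

lemma prod_le_A_const:
  assumes "even p" "0 \<le> \<nu>" "\<nu> \<le> 1"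
  shows "(\<Prod>i=1..p. \<nu> + real i) \<le> A_const p \<nu>"
proof -
  obtain m where m: "p = 2 * m" using assms(1) by (auto elim: evenE)
  have "poly (gpoly p (real p + \<nu>)) 1 = (\<Prod>i=1..p. \<nu> + real i)"
    by (simp add: poly_gpoly_1 prod_diff_eq_prod_add)
  moreover have "poly (gpoly p (real p + \<nu>)) 0
      = of_int (double_fact (int p - 1)) * (\<Prod>i=1..p div 2. \<nu> + 2 * real i)"
    using poly_gpoly_even_0_double_fact[of m \<nu>] by (simp add: m)
  ultimately show ?thesis
    using H_const_ge[OF assms(2,3), of p] assms(1) by (simp add: A_const_def)
qed

lemma prod_le_A_tilde_const:
  assumes "even p" "0 \<le> \<nu>"
  shows "(\<Prod>i=1..p. \<nu> + real i) \<le> A_tilde_const p \<nu>"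
proof -
  have "0 \<le> double_fact (int p - 1)"
    unfolding double_fact_def by (rule prod_nonneg) auto
  moreover have "0 \<le> (\<Prod>i=1..p div 2. \<nu> + 2 * real i)"
    using assms(2) by (intro prod_nonneg) auto
  ultimately show ?thesis
    using assms(1) by (simp add: A_tilde_const_def)
qed

theorem theorem6p3:
  fixes B :: "'a::euclidean_space \<Rightarrow> ('a \<Rightarrow>\<^sub>L real)" and p :: nat and \<nu> :: real
  assumes "selfadjoint_posdef B" and "0 \<le> \<nu>" and "\<nu> \<le> 1"
  shows "(\<forall>x. \<not> (odd p \<and> \<nu> = 0 \<and> x = 0) \<longrightarrow>
            nth_differentiable_at p (norm_power B (real p + \<nu>)) x) \<and>
         form_holder B p \<nu> (A_const p \<nu>) (nth_derivative p (norm_power B (real p + \<nu>))) \<and>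
         form_holder B p \<nu> (A_tilde_const p \<nu>) (nth_derivative p (norm_power B (real p + \<nu>)))"
proof (intro conjI allI impI)
  obtain M :: "('a \<Rightarrow> real) measure" and \<xi> N where "gaussian_functional M B \<xi> N"
    using gaussian_functional_exists[OF assms(1)] .
  then interpret gaussian_functional M B \<xi> N .
  show "nth_differentiable_at p (norm_power B (real p + \<nu>)) x"
    if "\<not> (odd p \<and> \<nu> = 0 \<and> x = 0)" for x
    using nth_frechet_norm_power[OF assms(2) order.refl, of p x] that by blast
  show "form_holder B p \<nu> (A_const p \<nu>) (nth_derivative p (norm_power B (real p + \<nu>)))"
  proof (rule form_holder_norm_power[OF assms])
    show "(if odd p then 2 powr (1 - \<nu>) else 1) * (\<Prod>i=1..p. \<nu> + real i) \<le> A_const p \<nu>"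
      using prod_le_A_const[OF _ assms(2,3), of p] by (cases "even p") (auto simp: A_const_def)
  qed
  show "form_holder B p \<nu> (A_tilde_const p \<nu>) (nth_derivative p (norm_power B (real p + \<nu>)))"
  proof (rule form_holder_norm_power[OF assms])
    show "(if odd p then 2 powr (1 - \<nu>) else 1) * (\<Prod>i=1..p. \<nu> + real i) \<le> A_tilde_const p \<nu>"
      using prod_le_A_tilde_const[OF _ assms(2), of p] by (cases "even p") (auto simp: A_tilde_const_def)
  qed
qed

end
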